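(* Let $1\le p\le\infty$ and $1/p+1/p'=1$. Suppose $X$ is a $p$-multinormed space. Then there exists a family of positive integers $(n_i)_{i\in I}$ so that $X$ embeds $p$-multiisometrically into $\big(\sum_{i\in I}\max_p(\ell^{p'}_{n_i})\big)_\infty$. If, moreover, $X$ is a dual $p$-multinormed space, then (for a suitable family of positive integers) the $p$-multiisometric embedding can be made weak$^*$ to weak$^*$ continuous.
   Context: All spaces are over the real field; $\mathbb{N}=\{1,2,\dots\}$. For $1\le p\le\infty$, a $p$-multinormed space is a Banach space $X$ together with, for each $n\in\mathbb{N}$, a norm $\|\cdot\|_n$ (written $\|\cdot\|$) on $\ell^p_n\otimes X$ such that: (1) $\|a\otimes x\|_n=\|a\|\,\|x\|$ for $a\in\ell^p_n$, $x\in X$; (2) $\|w\|_n\ge|\langle a^*\otimes x^*,w\rangle|$ for all $w\in\ell^p_n\otimes X$ and all $a^*\in(\ell^p_n)^*$, $x^*\in X^*$ of norm at most $1$; (3) $\|(T\otimes I_X)w\|_m\le\|T\|\,\|w\|_n$ for all $m,n$, all $T\in B(\ell^p_n,\ell^p_m)$ and all $w\in\ell^p_n\otimes X$. (This is equivalent to giving a left tensorial cross-norm on $\ell^p\otimes X$, or on $c_0\otimes X$ if $p=\infty$.) A linear map $u:X\to Y$ between $p$-multinormed spaces is a $p$-multiisometric embedding if $I_{\ell^p_n}\otimes u:\ell^p_n\otimes X\to\ell^p_n\otimes Y$ is isometric for every $n$. Duality: if $V$ is a $p$-multinormed space, its dual $V^*$ is the $p'$-multinormed space whose underlying Banach space is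 the Banach dual of $V$, with $\ell^{p'}_n\otimes V^*$ normed as the dual of $\ell^p_n\otimes V$ via $\langle\sum_i\delta_i'\otimes x_i^*,\sum_i\delta_i\otimes x_i\rangle=\sum_i\langle x_i^*,x_i\rangle$ ($\delta_i$, $\delta'_i$ the canonical bases of $\ell^p_n$, $\ell^{p'}_n$). $X$ is a dual $p$-multinormed space if $X=(X_* )^*$ for some $p'$-multinormed space $X_*$; its weak$^*$ topology is that given by $X_*$. For a Banach space $E$, $\max_p(E)$ (resp. $\min_p(E)$) is the $p$-multinormed space in which $\ell^p_n\otimes E$ carries the Banach space projective (resp. injective) tensor norm. The $\ell^\infty$ sum $(\sum_iX_i)_\infty$ of $p$-multinormed spaces has the Banach space $\ell^\infty$ sum as its underlying Banach space; an element of its tensor product with $\ell^p_n$ is a family $x=(x_i)$, $x_i\in\ell^p_n\otimes X_i$, and $\|x\|_n=\sup_i\|x_i\|_{\ell^p_n\otimes X_i}$. The $\ell^1$ sum $(\sum_iX_i)_1$ has the Banach space $\ell^1$ sum as its underlying space, with $\|x\|_n=\sum_i\|x_i\|_{\ell^p_n\otimes X_i}$. One has $\big((\sum_{i}\min_{p'}(\ell^{p}_{n_i}))_1\big)^*=\big(\sum_{i}\max_p(\ell^{p'}_{n_i})\big)_\infty$ (with $\ell^{p'}_{n}$ identified with $(\ell^p_n)^*$), and the weak$^*$ topology on the right-hand space is the one given by this predual. *)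

theory Defs
  imports "HOL-Analysis.Analysis" "HOL-Library.Function_Algebras"
begin

text \<open>
  Banach spaces are represented by a carrier subspace of an ambient real vector space together with
  a norm function, rather than by the class \<open>banach\<close>: the summands of
  \<open>(\<Sum>\<^sub>i max\<^sub>p(\<ell>\<^sup>p\<^sup>'\<^sub>n\<^sub>i))\<^sub>\<infinity>\<close> have varying dimensions, so they cannot be types.
  Ambient spaces are function spaces with pointwise operations. Norm functions are only meaningful
  on the carriers.
\<close>

instantiation "fun" :: (type, real_vector) real_vector
begin

definition scaleR_fun_def: "scaleR r f = (\<lambda>x. r *\<^sub>R f x)"

instance
  by standard (simp_all add: scaleR_fun_def fun_eq_iff scaleR_add_right scaleR_add_left)

end

lemma scaleR_fun_apply [simp]: "(r *\<^sub>R f) x = r *\<^sub>R f x"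
  by (simp add: scaleR_fun_def)


section \<open>Banach spaces\<close>

record 'a nspace =
  vecs :: "'a set"
  nrm :: "'a \<Rightarrow> real"

definition norm_on :: "'a::real_vector set \<Rightarrow> ('a \<Rightarrow> real) \<Rightarrow> bool" where
  "norm_on A N \<longleftrightarrow>
     (\<forall>x\<in>A. 0 \<le> N x \<and> (N x = 0 \<longleftrightarrow> x = 0)) \<and>
     (\<forall>c. \<forall>x\<in>A. N (c *\<^sub>R x) = \<bar>c\<bar> * N x) \<and>
     (\<forall>x\<in>A. \<forall>y\<in>A. N (x + y) \<le> N x + N y)"

definition banach_space :: "('a::real_vector, 'm) nspace_scheme \<Rightarrow> bool" where
  "banach_space E \<longleftrightarrow>
     subspace (vecs E) \<and> norm_on (vecs E) (nrm E) \<and>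
     (\<forall>s :: nat \<Rightarrow> 'a. (\<forall>k. s k \<in> vecs E) \<and>
         (\<forall>e>0. \<exists>M. \<forall>j\<ge>M. \<forall>k\<ge>M. nrm E (s j - s k) < e) \<longrightarrow>
         (\<exists>x\<in>vecs E. (\<lambda>k. nrm E (s k - x)) \<longlonglongrightarrow> 0))"

definition linear_map_on :: "'a::real_vector set \<Rightarrow> ('a \<Rightarrow> 'b::real_vector) \<Rightarrow> bool" where
  "linear_map_on A T \<longleftrightarrow>
     (\<forall>x\<in>A. \<forall>y\<in>A. T (x + y) = T x + T y) \<and> (\<forall>c. \<forall>x\<in>A. T (c *\<^sub>R x) = c *\<^sub>R T x)"

definition bounded_ops ::
  "('a::real_vector, 'm) nspace_scheme \<Rightarrow> ('b::real_vector, 'k) nspace_scheme \<Rightarrow> ('a \<Rightarrow> 'b) set" where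
  "bounded_ops E F =
     {T. T ` vecs E \<subseteq> vecs F \<and> linear_map_on (vecs E) T \<and>
         (\<exists>C. \<forall>x\<in>vecs E. nrm F (T x) \<le> C * nrm E x)}"

definition op_norm ::
  "('a::real_vector, 'm) nspace_scheme \<Rightarrow> ('b::real_vector, 'k) nspace_scheme \<Rightarrow> ('a \<Rightarrow> 'b) \<Rightarrow> real" where
  "op_norm E F T = Sup {nrm F (T x) |x. x \<in> vecs E \<and> nrm E x \<le> 1}"

definition real_space :: "real nspace" where
  "real_space = \<lparr>vecs = UNIV, nrm = abs\<rparr>"

text \<open>Functionals are extended by \<open>0\<close> off the carrier, so that each is represented exactly once.\<close>

definition bdual :: "('a::real_vector, 'm) nspace_scheme \<Rightarrow> ('a \<Rightarrow> real) nspace" where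
  "bdual E = \<lparr>vecs = {f \<in> bounded_ops E real_space. \<forall>x. x \<notin> vecs E \<longrightarrow> f x = 0},
              nrm = op_norm E real_space\<rparr>"


section \<open>The spaces \<open>\<ell>\<^sup>p\<^sub>n\<close> and tensor products with them\<close>

definition lp_norm :: "ennreal \<Rightarrow> nat \<Rightarrow> (nat \<Rightarrow> real) \<Rightarrow> real" where
  "lp_norm p n a =
     (if p = \<infinity> then Max ((\<lambda>i. \<bar>a i\<bar>) ` {..<n})
      else (\<Sum>i<n. \<bar>a i\<bar> powr enn2real p) powr (1 / enn2real p))"

definition lp_space :: "ennreal \<Rightarrow> nat \<Rightarrow> (nat \<Rightarrow> real) nspace" where
  "lp_space p n = \<lparr>vecs = {a. \<forall>i\<ge>n. a i = 0}, nrm = lp_norm p n\<rparr>"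

definition delta :: "nat \<Rightarrow> nat \<Rightarrow> real" where
  "delta j = (\<lambda>i. if i = j then 1 else 0)"

text \<open>
  The element \<open>\<Sum>\<^sub>i\<^sub><\<^sub>n \<delta>\<^sub>i \<otimes> w i\<close> of \<open>\<ell>\<^sup>p\<^sub>n \<otimes> X\<close> is represented by its coefficient sequence
  \<open>w\<close>, with coordinates numbered from \<open>0\<close> and padded with \<open>0\<close> from \<open>n\<close> on. Hence \<open>I \<otimes> u\<close> is
  composition with \<open>u\<close>.
\<close>

definition tens :: "nat \<Rightarrow> 'a::real_vector set \<Rightarrow> (nat \<Rightarrow> 'a) set" where
  "tens n A = {w. (\<forall>i<n. w i \<in> A) \<and> (\<forall>i\<ge>n. w i = 0)}"

definition elem_tens :: "(nat \<Rightarrow> real) \<Rightarrow> 'a::real_vector \<Rightarrow> nat \<Rightarrow> 'a" where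
  "elem_tens a x = (\<lambda>i. a i *\<^sub>R x)"

definition op_tens_id ::
  "nat \<Rightarrow> ((nat \<Rightarrow> real) \<Rightarrow> nat \<Rightarrow> real) \<Rightarrow> (nat \<Rightarrow> 'a::real_vector) \<Rightarrow> nat \<Rightarrow> 'a" where
  "op_tens_id n T w = (\<Sum>j<n. elem_tens (T (delta j)) (w j))"

definition functional_tens ::
  "nat \<Rightarrow> ((nat \<Rightarrow> real) \<Rightarrow> real) \<Rightarrow> ('a \<Rightarrow> real) \<Rightarrow> (nat \<Rightarrow> 'a) \<Rightarrow> real" where
  "functional_tens n a' x' w = (\<Sum>j<n. a' (delta j) * x' (w j))"


section \<open>\<open>p\<close>-multinormed spaces\<close>

record 'a mnspace = "'a nspace" +
  mnrm :: "nat \<Rightarrow> (nat \<Rightarrow> 'a) \<Rightarrow> real"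

definition multinormed :: "ennreal \<Rightarrow> 'a::real_vector mnspace \<Rightarrow> bool" where
  "multinormed p X \<longleftrightarrow>
     banach_space X \<and>
     (\<forall>n\<ge>1. norm_on (tens n (vecs X)) (mnrm X n)) \<and>
     (\<forall>n\<ge>1. \<forall>a\<in>vecs (lp_space p n). \<forall>x\<in>vecs X.
        mnrm X n (elem_tens a x) = nrm (lp_space p n) a * nrm X x) \<and>
     (\<forall>n\<ge>1. \<forall>w\<in>tens n (vecs X).
        \<forall>a'\<in>vecs (bdual (lp_space p n)). \<forall>x'\<in>vecs (bdual X).
        nrm (bdual (lp_space p n)) a' \<le> 1 \<and> nrm (bdual X) x' \<le> 1 \<longrightarrow>
        \<bar>functional_tens n a' x' w\<bar> \<le> mnrm X n w) \<and>
     (\<forall>m\<ge>1. \<forall>n\<ge>1. \<forall>T\<in>bounded_ops (lp_space p n) (lp_space p m). \<forall>w\<in>tens n (vecs X).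
        mnrm X m (op_tens_id n T w) \<le> op_norm (lp_space p n) (lp_space p m) T * mnrm X n w)"

definition multiisometric_embedding ::
  "'a::real_vector mnspace \<Rightarrow> 'b::real_vector mnspace \<Rightarrow> ('a \<Rightarrow> 'b) \<Rightarrow> bool" where
  "multiisometric_embedding X Y u \<longleftrightarrow>
     u ` vecs X \<subseteq> vecs Y \<and> linear_map_on (vecs X) u \<and>
     (\<forall>n\<ge>1. \<forall>w\<in>tens n (vecs X). mnrm Y n (\<lambda>i. u (w i)) = mnrm X n w)"

definition max_mn :: "ennreal \<Rightarrow> ('a::real_vector, 'm) nspace_scheme \<Rightarrow> 'a mnspace" where
  "max_mn p E = \<lparr>vecs = vecs E, nrm = nrm E,
     mnrm = (\<lambda>n w. Inf {\<Sum>k<m. nrm (lp_space p n) (a k) * nrm E (x k) |(m::nat) a x.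
       (\<forall>k<m. a k \<in> vecs (lp_space p n) \<and> x k \<in> vecs E) \<and>
       w = (\<Sum>k<m. elem_tens (a k) (x k))})\<rparr>"

definition min_mn :: "ennreal \<Rightarrow> ('a::real_vector, 'm) nspace_scheme \<Rightarrow> 'a mnspace" where
  "min_mn p E = \<lparr>vecs = vecs E, nrm = nrm E,
     mnrm = (\<lambda>n w. Sup {\<bar>functional_tens n a' x' w\<bar> |a' x'.
       a' \<in> vecs (bdual (lp_space p n)) \<and> nrm (bdual (lp_space p n)) a' \<le> 1 \<and>
       x' \<in> vecs (bdual E) \<and> nrm (bdual E) x' \<le> 1})\<rparr>"

text \<open>The \<open>0\<close> inserted below only matters for the empty index set.\<close>

definition linf_sum :: "'i set \<Rightarrow> ('i \<Rightarrow> 'a::real_vector mnspace) \<Rightarrow> ('i \<Rightarrow> 'a) mnspace" where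
  "linf_sum I Y = \<lparr>
     vecs = {x. (\<forall>i\<in>I. x i \<in> vecs (Y i)) \<and> (\<forall>i. i \<notin> I \<longrightarrow> x i = 0) \<and>
                bdd_above ((\<lambda>i. nrm (Y i) (x i)) ` I)},
     nrm = (\<lambda>x. Sup (insert 0 ((\<lambda>i. nrm (Y i) (x i)) ` I))),
     mnrm = (\<lambda>n w. Sup (insert 0 ((\<lambda>i. mnrm (Y i) n (\<lambda>k. w k i)) ` I)))\<rparr>"

definition l1_sum :: "'i set \<Rightarrow> ('i \<Rightarrow> 'a::real_vector mnspace) \<Rightarrow> ('i \<Rightarrow> 'a) mnspace" where
  "l1_sum I Y = \<lparr>
     vecs = {x. (\<forall>i\<in>I. x i \<in> vecs (Y i)) \<and> (\<forall>i. i \<notin> I \<longrightarrow> x i = 0) \<and>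
                (\<lambda>i. nrm (Y i) (x i)) summable_on I},
     nrm = (\<lambda>x. \<Sum>\<^sub>\<infinity>i\<in>I. nrm (Y i) (x i)),
     mnrm = (\<lambda>n w. \<Sum>\<^sub>\<infinity>i\<in>I. mnrm (Y i) n (\<lambda>k. w k i))\<rparr>"


section \<open>Duality\<close>

text \<open>The dual of a \<open>p\<close>-multinormed space, as a \<open>p'\<close>-multinormed space; the formula does not
  involve \<open>p\<close>.\<close>

definition mdual :: "'a::real_vector mnspace \<Rightarrow> ('a \<Rightarrow> real) mnspace" where
  "mdual V = \<lparr>vecs = vecs (bdual V), nrm = nrm (bdual V),
     mnrm = (\<lambda>n f. Sup {\<bar>\<Sum>i<n. f i (w i)\<bar> |w. w \<in> tens n (vecs V) \<and> mnrm V n w \<le> 1})\<rparr>"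

text \<open>
  The identification \<open>X = V\<^sup>*\<close> is given by a pairing \<open>B\<close> of \<open>X\<close> with \<open>V\<close>: sending \<open>x\<close> to the
  functional \<open>B x\<close> is a multiisometric isomorphism of \<open>X\<close> onto \<open>mdual V\<close>. If \<open>X\<close> is literally
  \<open>mdual V\<close>, then \<open>B\<close> is evaluation.
\<close>

definition is_dual_via ::
  "'a::real_vector mnspace \<Rightarrow> 'v::real_vector mnspace \<Rightarrow> ('a \<Rightarrow> 'v \<Rightarrow> real) \<Rightarrow> bool" where
  "is_dual_via X V B \<longleftrightarrow>
     (let J = (\<lambda>x v. if v \<in> vecs V then B x v else 0)
      in multiisometric_embedding X (mdual V) J \<and> J ` vecs X = vecs (mdual V))"

definition weak_star_topology ::
  "'a mnspace \<Rightarrow> 'v mnspace \<Rightarrow> ('a \<Rightarrow> 'v \<Rightarrow> real) \<Rightarrow> 'a topology" where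
  "weak_star_topology X V B =
     pullback_topology (vecs X) (\<lambda>x. restrict (B x) (vecs V))
       (product_topology (\<lambda>_. euclideanreal) (vecs V))"

definition max_sum :: "ennreal \<Rightarrow> ennreal \<Rightarrow> 'i set \<Rightarrow> ('i \<Rightarrow> nat) \<Rightarrow> ('i \<Rightarrow> nat \<Rightarrow> real) mnspace" where
  "max_sum p p' I N = linf_sum I (\<lambda>i. max_mn p (lp_space p' (N i)))"

definition min_sum :: "ennreal \<Rightarrow> ennreal \<Rightarrow> 'i set \<Rightarrow> ('i \<Rightarrow> nat) \<Rightarrow> ('i \<Rightarrow> nat \<Rightarrow> real) mnspace" where
  "min_sum p p' I N = l1_sum I (\<lambda>i. min_mn p' (lp_space p (N i)))"

text \<open>The pairing through which \<open>max_sum p p' I N\<close> is the dual of \<open>min_sum p p' I N\<close>.\<close>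

definition sum_pairing ::
  "'i set \<Rightarrow> ('i \<Rightarrow> nat) \<Rightarrow> ('i \<Rightarrow> nat \<Rightarrow> real) \<Rightarrow> ('i \<Rightarrow> nat \<Rightarrow> real) \<Rightarrow> real" where
  "sum_pairing I N x y = (\<Sum>\<^sub>\<infinity>i\<in>I. \<Sum>j<N i. x i j * y i j)"

end

theory Submission
  imports Defs
begin

text \<open>
  A functional \<open>f = (f\<^sub>j)\<close> in the unit ball of \<open>(\<ell>\<^sup>p\<^sub>n \<otimes> X)\<^sup>*\<close> is a map
  \<open>x \<mapsto> (f\<^sub>j x)\<^sub>j\<close> from \<open>X\<close> to \<open>\<ell>\<^sup>p\<^sup>'\<^sub>n\<close>. It is a contraction into
  \<open>max\<^sub>p(\<ell>\<^sup>p\<^sup>'\<^sub>n)\<close>: the projective norm on \<open>\<ell>\<^sup>p\<^sub>m \<otimes> \<ell>\<^sup>p\<^sup>'\<^sub>n\<close> is normed by bilinear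
  forms, that is by contractions \<open>S : \<ell>\<^sup>p\<^sub>m \<rightarrow> \<ell>\<^sup>p\<^sub>n\<close>, and pairing \<open>S\<close> with the image of
  \<open>z\<close> gives \<open>f ((S \<otimes> I) z)\<close>. Conversely \<open>f z\<close> is the trace of the image of \<open>z\<close>, which is at
  most its projective norm. So the sum of these maps over any norming set of functionals \<open>f\<close> is a
  multiisometric embedding. For general \<open>X\<close> a norming set comes from the Hahn--Banach theorem; if
  \<open>X = V\<^sup>*\<close> then the unit balls of \<open>\<ell>\<^sup>p\<^sup>'\<^sub>n \<otimes> V\<close> are norming. In the latter case the embedding
  has a preadjoint, because an element of the \<open>\<ell>\<^sup>1\<close> sum is sent to an absolutely convergent series
  in \<open>V\<close>; hence it is weak* continuous.
\<close>

section \<open>The Hahn--Banach theorem\<close>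

definition sublinear :: "('b::real_vector \<Rightarrow> real) \<Rightarrow> bool" where
  "sublinear q \<longleftrightarrow> (\<forall>x y. q (x + y) \<le> q x + q y) \<and> (\<forall>c x. 0 \<le> c \<longrightarrow> q (c *\<^sub>R x) = c * q x)"

lemma sublinear_add: "sublinear q \<Longrightarrow> q (x + y) \<le> q x + q y"
  and sublinear_scale: "sublinear q \<Longrightarrow> 0 \<le> c \<Longrightarrow> q (c *\<^sub>R x) = c * q x"
  by (simp_all add: sublinear_def)

lemma sublinear_zero: "sublinear q \<Longrightarrow> q 0 = 0"
  using sublinear_scale[of q 0 0] by simp

lemma sublinear_minus_le: "sublinear q \<Longrightarrow> - q (- x) \<le> q x"
  using sublinear_add[of q x "- x"] sublinear_zero[of q] by simp

text \<open>The upper bound for \<open>inverse c\<close>, taken at the scaled point, is the missing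
  lower bound for \<open>c\<close>.\<close>

lemma sublinearI:
  assumes add: "\<And>x y. q (x + y) \<le> q x + q y"
    and le: "\<And>c x. 0 < c \<Longrightarrow> q (c *\<^sub>R x) \<le> c * q x"
    and zero: "q 0 = 0"
  shows "sublinear q"
  unfolding sublinear_def
proof (intro conjI allI impI)
  fix c :: real and x assume "0 \<le> c"
  show "q (c *\<^sub>R x) = c * q x"
  proof (cases "c = 0")
    case True
    then show ?thesis by (simp add: zero)
  next
    case False
    with \<open>0 \<le> c\<close> have c: "0 < c" by simp
    have "q x \<le> inverse c * q (c *\<^sub>R x)"
      using le[of "inverse c" "c *\<^sub>R x"] c by simp
    then have "c * q x \<le> q (c *\<^sub>R x)"
      using c by (simp add: field_simps)
    then show ?thesis using le[OF c, of x] by simp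
  qed
qed (rule add)

text \<open>The \<open>r\<close> constructed is the largest sublinear functional with these
  properties: any such \<open>s\<close> satisfies s y \<le> s (y + t z) + t s (- z) \<le>
  \<open>h y t\<close> for t \<ge> 0, so the infimum over \<open>t\<close> is the natural
  candidate.\<close>

lemma sublinear_descent:
  assumes q: "sublinear q"
  shows "\<exists>r. sublinear r \<and> r \<le> q \<and> r (- z) \<le> - q z"
proof -
  define h where "h y t = q (y + t *\<^sub>R z) - t * q z" for y t
  define r where "r y = (INF t\<in>{0..}. h y t)" for y
  \<comment> \<open>Subadditivity on t z = (y + t z) + (- y) gives a bound independent of
    \<open>t\<close>, so the infimum is a real number.\<close>
  have lower: "- q (- y) \<le> h y t" if "0 \<le> t" for y t
    using sublinear_add[OF q, of "y + t *\<^sub>R z" "- y"] sublinear_scale[OF q that, of z]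
    by (simp add: h_def)
  have bdd: "bdd_below (h y ` {0..})" for y
    using lower by (auto intro!: bdd_belowI)
  have r_le: "r y \<le> h y t" if "0 \<le> t" for y t
    unfolding r_def using that by (intro cINF_lower bdd) auto
  have r_ge: "b \<le> r y" if "\<And>t. 0 \<le> t \<Longrightarrow> b \<le> h y t" for b y
    unfolding r_def using that by (intro cINF_greatest) auto
  have "sublinear r"
  proof (rule sublinearI)
    fix x y
    \<comment> \<open>The parameter \<open>s + t\<close> is admissible for \<open>x + y\<close>; the
      two infima are then taken one after the other.\<close>
    have *: "r (x + y) - h x s \<le> r y" if "0 \<le> s" for s
    proof (rule r_ge)
      fix t :: real assume "0 \<le> t"
      have "r (x + y) \<le> h (x + y) (s + t)"
        using that \<open>0 \<le> t\<close> by (intro r_le) simp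
      also have "\<dots> \<le> h x s + h y t"
        using sublinear_add[OF q, of "x + s *\<^sub>R z" "y + t *\<^sub>R z"]
        by (simp add: h_def algebra_simps)
      finally show "r (x + y) - h x s \<le> h y t" by simp
    qed
    have "r (x + y) - r y \<le> r x"
      by (rule r_ge) (use * in force)
    then show "r (x + y) \<le> r x + r y" by simp
  next
    fix c :: real and x assume c: "0 < c"
    have "inverse c * r (c *\<^sub>R x) \<le> r x"
    proof (rule r_ge)
      fix t :: real assume "0 \<le> t"
      have "r (c *\<^sub>R x) \<le> h (c *\<^sub>R x) (c * t)"
        using c \<open>0 \<le> t\<close> by (intro r_le) simp
      also have "\<dots> = c * h x t"
        using sublinear_scale[OF q, of c "x + t *\<^sub>R z"] c by (simp add: h_def algebra_simps)
      finally show "inverse c * r (c *\<^sub>R x) \<le> h x t"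
        using c by (simp add: field_simps)
    qed
    then show "r (c *\<^sub>R x) \<le> c * r x"
      using c by (simp add: field_simps)
  next
    have "r 0 \<le> 0" using r_le[of 0 0] sublinear_zero[OF q] by (simp add: h_def)
    moreover have "0 \<le> r 0"
      by (rule r_ge) (use lower[of _ 0] sublinear_zero[OF q] in simp)
    ultimately show "r 0 = 0" by simp
  qed
  moreover have "r \<le> q"
    using r_le[of 0] by (auto simp: le_fun_def h_def)
  moreover have "r (- z) \<le> - q z"
    using r_le[of 1 "- z"] sublinear_zero[OF q] by (simp add: h_def)
  ultimately show ?thesis by blast
qed

text \<open>A minimal sublinear functional is linear: it is not lowered by \<open>sublinear_descent\<close>.\<close>

lemma sublinear_linear_minorant:
  assumes q: "sublinear q"
  shows "\<exists>f. linear f \<and> (\<forall>x. f x \<le> q x) \<and> f z = q z"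
proof -
  \<comment> \<open>One descent at \<open>z\<close> before minimising: everything below
    \<open>r\<close> is at most \<open>- q z\<close> at \<open>- z\<close>, which becomes equality
    with \<open>q\<close> at \<open>z\<close> once the minimal functional is known to be
    odd.\<close>
  obtain r where r: "sublinear r" "r \<le> q" "r (- z) \<le> - q z"
    using sublinear_descent[OF q] by blast
  define A where "A = {s. sublinear s \<and> s \<le> r}"
  have "\<exists>m\<in>A. \<forall>a\<in>A. a \<le> m \<longrightarrow> a = m"
  \<comment> \<open>Zorn in the reversed order: a nonempty chain is bounded below by its pointwise
    infimum, the empty one by \<open>r\<close>.\<close>
  proof (rule predicate_Zorn[where P = "\<lambda>a b. b \<le> a"])
    show "partial_order_on A (relation_of (\<lambda>a b. b \<le> a) A)"
      by (rule partial_order_on_relation_ofI) auto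
  next
    fix C assume C: "C \<in> Chains (relation_of (\<lambda>a b. b \<le> a) A)"
    show "\<exists>u\<in>A. \<forall>a\<in>C. u \<le> a"
    proof (cases "C = {}")
      case True
      then show ?thesis using r by (auto simp: A_def)
    next
      case False
      have sub: "sublinear s" "s \<le> r" if "s \<in> C" for s
        using C that by (auto simp: Chains_def relation_of_def A_def)
      have tot: "s \<le> t \<or> t \<le> s" if "s \<in> C" "t \<in> C" for s t
        using C that by (auto simp: Chains_def relation_of_def)
      define u where "u x = (INF s\<in>C. s x)" for x
      have low: "- r (- x) \<le> s x" if "s \<in> C" for s x
        using sublinear_minus_le[OF sub(1)[OF that], of x] le_funD[OF sub(2)[OF that], of "- x"] by simp
      have bdd: "bdd_below ((\<lambda>s. s x) ` C)" for x
        using low by (auto intro!: bdd_belowI)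
      have u_le: "u x \<le> s x" if "s \<in> C" for s x
        unfolding u_def using that by (intro cINF_lower bdd) auto
      have u_ge: "b \<le> u x" if "\<And>s. s \<in> C \<Longrightarrow> b \<le> s x" for b x
        unfolding u_def using that False by (intro cINF_greatest) auto
      have "sublinear u"
      proof (rule sublinearI)
        fix x y
        have *: "u (x + y) - s x \<le> u y" if s: "s \<in> C" for s
        proof (rule u_ge)
          fix t assume t: "t \<in> C"
          \<comment> \<open>Two members of the chain are comparable, and the smaller one can be used
            at both points.\<close>
          have "u (x + y) \<le> s x + t y"
          proof (cases "s \<le> t")
            case True
            have "u (x + y) \<le> s x + s y"
              using u_le[OF s, of "x + y"] sublinear_add[OF sub(1)[OF s], of x y] by simp
            with le_funD[OF True, of y] show ?thesis by simp
          next
            case False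
            then have "t \<le> s" using tot s t by blast
            have "u (x + y) \<le> t x + t y"
              using u_le[OF t, of "x + y"] sublinear_add[OF sub(1)[OF t], of x y] by simp
            with le_funD[OF \<open>t \<le> s\<close>, of x] show ?thesis by simp
          qed
          then show "u (x + y) - s x \<le> t y" by simp
        qed
        have "u (x + y) - u y \<le> u x"
          by (rule u_ge) (use * in force)
        then show "u (x + y) \<le> u x + u y" by simp
      next
        fix c :: real and x assume c: "0 < c"
        have "inverse c * u (c *\<^sub>R x) \<le> u x"
        proof (rule u_ge)
          fix s assume s: "s \<in> C"
          have "u (c *\<^sub>R x) \<le> c * s x"
            using u_le[OF s, of "c *\<^sub>R x"] sublinear_scale[OF sub(1)[OF s], of c x] c by simp
          then show "inverse c * u (c *\<^sub>R x) \<le> s x"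
            using c by (simp add: field_simps)
        qed
        then show "u (c *\<^sub>R x) \<le> c * u x"
          using c by (simp add: field_simps)
      next
        have "(\<lambda>s. s 0) ` C = {0}"
          using False sublinear_zero[OF sub(1)] by force
        then show "u 0 = 0" by (simp add: u_def)
      qed
      moreover have "u \<le> r"
      proof -
        obtain s where "s \<in> C" using False by blast
        then show ?thesis using u_le[of s] sub(2)[of s] by (auto simp: le_fun_def intro: order_trans)
      qed
      ultimately show ?thesis
        using u_le by (auto simp: A_def le_fun_def intro!: bexI[of _ u])
    qed
  qed
  then obtain m where m: "sublinear m" "m \<le> r" and min: "\<And>a. sublinear a \<Longrightarrow> a \<le> m \<Longrightarrow> a = m"
    unfolding A_def by (metis (mono_tags, lifting) mem_Collect_eq order_trans)
  have neg: "m (- x) = - m x" for x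
  proof -
    obtain s where "sublinear s" "s \<le> m" "s (- x) \<le> - m x"
      using sublinear_descent[OF m(1)] by blast
    with min have "m (- x) \<le> - m x" by blast
    with sublinear_minus_le[OF m(1), of x] show ?thesis by simp
  qed
  \<comment> \<open>Oddness turns subadditivity into additivity, by splitting x as (x + y) + (-
    y).\<close>
  have "linear m"
  proof (rule linearI)
    fix x y
    show "m (x + y) = m x + m y"
      using sublinear_add[OF m(1), of x y] sublinear_add[OF m(1), of "x + y" "- y"]
      by (simp add: neg)
  next
    fix c x
    show "m (c *\<^sub>R x) = c *\<^sub>R m x"
    proof (cases "0 \<le> c")
      case True
      then show ?thesis using sublinear_scale[OF m(1)] by simp
    next
      case False
      then show ?thesis
        using sublinear_scale[OF m(1), of "- c" x] neg[of "c *\<^sub>R x"] by simp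
    qed
  qed
  moreover have "m x \<le> q x" for x
    using m(2) r(2) by (auto simp: le_fun_def intro: order_trans)
  moreover have "m z = q z"
  proof (rule antisym)
    have "m (- z) \<le> - q z" using m(2) r(3) by (auto simp: le_fun_def intro: order_trans)
    then show "q z \<le> m z" by (simp add: neg)
  qed fact
  ultimately show ?thesis by blast
qed

lemma subspace_projection:
  assumes "subspace (A :: 'b::real_vector set)"
  shows "\<exists>P. linear P \<and> range P \<subseteq> A \<and> (\<forall>x\<in>A. P x = x)"
  using real_vector.linear_exists_left_inverse_on[where f = id, OF real_vector.linear_id assms]
  by (auto simp: linear_def)

text \<open>\<open>N\<close> is only controlled on \<open>A\<close>, whereas sublinear functionals
  live on the whole ambient space; composing with an algebraic projection onto \<open>A\<close>
  bridges the gap. Evaluating the linear minorant at both x and - x bounds its absolute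
  value.\<close>

lemma norming_functional:
  assumes A: "subspace A" and z: "z \<in> A"
    and add: "\<And>x y. x \<in> A \<Longrightarrow> y \<in> A \<Longrightarrow> N (x + y) \<le> N x + N y"
    and scale: "\<And>c x. x \<in> A \<Longrightarrow> N (c *\<^sub>R x) = \<bar>c\<bar> * N x"
  shows "\<exists>f. linear f \<and> (\<forall>x\<in>A. \<bar>f x\<bar> \<le> N x) \<and> f z = N z"
proof -
  obtain P where P: "linear P" "range P \<subseteq> A" "\<forall>x\<in>A. P x = x"
    using subspace_projection[OF A] by blast
  have "sublinear (\<lambda>x. N (P x))"
    unfolding sublinear_def using P add scale
    by (auto simp: linear_add linear_scale image_subset_iff)
  then obtain f where f: "linear f" "\<And>x. f x \<le> N (P x)" "f z = N (P z)"
    using sublinear_linear_minorant by blast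
  have "\<bar>f x\<bar> \<le> N x" if x: "x \<in> A" for x
  proof -
    have "N (- x) = N x" using scale[OF x, of "- 1"] by simp
    with f(2)[of x] f(2)[of "- x"] show ?thesis
      using P x subspace_neg[OF A x] by (simp add: linear_neg[OF f(1)])
  qed
  with f P z show ?thesis by auto
qed


section \<open>Duality of finite \<open>\<ell>\<^sup>p\<close> norms\<close>

lemma conjugate_exponent_cases:
  assumes "1 \<le> p" "1 / p + 1 / p' = (1::ennreal)"
  obtains "p = 1" "p' = \<infinity>" | "p = \<infinity>" "p' = 1"
  | P Q where "1 < P" "1 < Q" "1 / P + 1 / Q = 1" "p = ennreal P" "p' = ennreal Q"
proof (cases p)
  case top
  then have "1 / p' = 1" using assms by simp
  then have "p' = 1" by (simp add: divide_eq_1_ennreal)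
  with top that show ?thesis by simp
next
  case (real P)
  then have P: "1 \<le> P" using assms by simp
  have pi: "1 / p = ennreal (1 / P)"
    using P real by (simp add: divide_ennreal flip: ennreal_1)
  show ?thesis
  proof (cases p')
    case top
    then have "ennreal (1 / P) = 1" using assms pi by simp
    then have "p = 1" using P real by simp
    with top that show ?thesis by simp
  next
    case (real Q)
    \<comment> \<open>In \<open>ennreal\<close> the quotient 1 / 0 is infinite, which the conjugacy
      equation excludes.\<close>
    have "Q \<noteq> 0"
    proof
      assume "Q = 0"
      then have "1 / p' = \<infinity>" using real by simp
      then show False using assms by simp
    qed
    then have Q: "0 < Q" using real by simp
    have "1 / p' = ennreal (1 / Q)"
      using Q real by (simp add: divide_ennreal flip: ennreal_1)
    then have e: "1 / P + 1 / Q = 1"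
      using assms pi P Q by (simp flip: ennreal_plus)
    have "0 < 1 / Q" "0 < 1 / P" using P Q by simp_all
    with e have "1 / P < 1" "1 / Q < 1" by linarith+
    with P Q have "1 < P" "1 < Q" by (simp_all add: field_simps)
    then show ?thesis using e that real \<open>p = ennreal P\<close> by blast
  qed
qed

lemma conjugate_exponent_sym:
  assumes "1 \<le> p" "1 / p + 1 / p' = (1::ennreal)"
  shows "1 \<le> p'" "1 / p' + 1 / p = 1"
  using assms by (auto elim!: conjugate_exponent_cases simp: add.commute)

lemma lp_norm_top: "lp_norm top n a = Max ((\<lambda>i. \<bar>a i\<bar>) ` {..<n})"
  by (simp add: lp_norm_def)

lemma lp_norm_one: "lp_norm 1 n a = (\<Sum>i<n. \<bar>a i\<bar>)"
  by (simp add: lp_norm_def sum_nonneg)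

lemma lp_norm_real: "0 \<le> P \<Longrightarrow> lp_norm (ennreal P) n a = (\<Sum>i<n. \<bar>a i\<bar> powr P) powr (1 / P)"
  by (simp add: lp_norm_def)

lemma abs_le_lp_norm_top: "i < n \<Longrightarrow> \<bar>a i\<bar> \<le> lp_norm top n a"
  by (auto simp: lp_norm_top intro!: Max_ge)

lemma lp_norm_nonneg: "1 \<le> n \<Longrightarrow> 0 \<le> lp_norm p n a"
  using order_trans[OF abs_ge_zero abs_le_lp_norm_top[of 0 n a]]
  by (cases "p = \<infinity>") (auto simp: lp_norm_def)

lemma lp_norm_scale:
  assumes "1 \<le> p" "1 \<le> n"
  shows "lp_norm p n (\<lambda>i. c * a i) = \<bar>c\<bar> * lp_norm p n a"
proof (cases p)
  case top
  have "(\<lambda>i. \<bar>c * a i\<bar>) ` {..<n} = (*) \<bar>c\<bar> ` (\<lambda>i. \<bar>a i\<bar>) ` {..<n}"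
    by (simp add: image_image abs_mult)
  moreover have "Max ((*) \<bar>c\<bar> ` (\<lambda>i. \<bar>a i\<bar>) ` {..<n}) = \<bar>c\<bar> * Max ((\<lambda>i. \<bar>a i\<bar>) ` {..<n})"
    using assms by (intro mono_Max_commute[symmetric]) (auto simp: mono_def mult_left_mono lessThan_empty_iff)
  ultimately show ?thesis using top by (simp add: lp_norm_def)
next
  case (real P)
  then have P: "1 \<le> P" using assms by simp
  have "(\<Sum>i<n. \<bar>c * a i\<bar> powr P) = \<bar>c\<bar> powr P * (\<Sum>i<n. \<bar>a i\<bar> powr P)"
    by (simp add: abs_mult powr_mult sum_distrib_left)
  then show ?thesis
    using P real by (simp add: lp_norm_real powr_mult powr_powr sum_nonneg)
qed

lemma lp_norm_one_top_le:
  assumes "1 \<le> n"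
  shows "\<bar>\<Sum>i<n. a i * b i\<bar> \<le> lp_norm 1 n a * lp_norm top n b"
proof -
  have "\<bar>\<Sum>i<n. a i * b i\<bar> \<le> (\<Sum>i<n. \<bar>a i\<bar> * lp_norm top n b)"
    by (rule order_trans[OF sum_abs sum_mono])
      (auto simp: abs_mult intro!: mult_left_mono abs_le_lp_norm_top)
  then show ?thesis by (simp add: lp_norm_one sum_distrib_right)
qed

lemma lp_norm_real_eq_0:
  assumes "0 < P" "lp_norm (ennreal P) n a = 0" "i < n"
  shows "a i = 0"
proof -
  have "(\<Sum>i<n. \<bar>a i\<bar> powr P) = 0"
    using assms by (simp add: lp_norm_real)
  then show ?thesis using assms by (simp add: sum_nonneg_eq_0_iff)
qed

lemma lp_norm_real_powr:
  assumes "0 < P"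
  shows "lp_norm (ennreal P) n a powr P = (\<Sum>i<n. \<bar>a i\<bar> powr P)"
  using assms by (simp add: lp_norm_real powr_powr sum_nonneg)

text \<open>For finite exponents above 1, both vectors are normalised and Young's inequality is
  summed over the coordinates, giving 1/P + 1/Q = 1. A vector of norm 0 cannot be normalised and is
  split off.\<close>

lemma holder_sum:
  assumes p: "1 \<le> p" "1 / p + 1 / p' = 1" and n: "1 \<le> n"
  shows "\<bar>\<Sum>i<n. a i * b i\<bar> \<le> lp_norm p n a * lp_norm p' n b"
  using p
proof (cases rule: conjugate_exponent_cases)
  case 1
  then show ?thesis using lp_norm_one_top_le[OF n] by simp
next
  case 2
  then show ?thesis using lp_norm_one_top_le[OF n, of b a] by (simp add: mult.commute)
next
  case (3 P Q)
  define A B where "A = lp_norm p n a" and "B = lp_norm p' n b"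
  have nn: "0 \<le> A" "0 \<le> B" using n by (auto simp: A_def B_def lp_norm_nonneg)
  show ?thesis
  proof (cases "A = 0 \<or> B = 0")
    case True
    then have "\<forall>i<n. a i * b i = 0"
      using lp_norm_real_eq_0[of P n a] lp_norm_real_eq_0[of Q n b] 3 by (auto simp: A_def B_def)
    then have "(\<Sum>i<n. a i * b i) = 0" by (intro sum.neutral) auto
    then show ?thesis using nn by (simp add: A_def B_def)
  next
    case False
    then have pos: "0 < A" "0 < B" using nn by auto
    have "(\<Sum>i<n. \<bar>a i\<bar> / A * (\<bar>b i\<bar> / B)) \<le>
        (\<Sum>i<n. (\<bar>a i\<bar> / A) powr P / P + (\<bar>b i\<bar> / B) powr Q / Q)"
      using 3 pos by (intro sum_mono Youngs_inequality) auto
    also have "\<dots> = (\<Sum>i<n. \<bar>a i\<bar> powr P) / A powr P / P + (\<Sum>i<n. \<bar>b i\<bar> powr Q) / B powr Q / Q"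
      using pos by (simp add: sum.distrib powr_divide sum_divide_distrib)
    also have "\<dots> = 1 / P + 1 / Q"
      using lp_norm_real_powr[of P n a] lp_norm_real_powr[of Q n b] 3 pos
      by (simp add: A_def B_def flip: lp_norm_real_powr)
    finally have "(\<Sum>i<n. \<bar>a i * b i\<bar>) / (A * B) \<le> 1"
      using 3 by (simp add: abs_mult sum_divide_distrib)
    then have "(\<Sum>i<n. \<bar>a i * b i\<bar>) \<le> A * B"
      using pos by (simp add: field_simps)
    then show ?thesis
      unfolding A_def B_def by (rule order_trans[OF sum_abs])
  qed
qed

text \<open>The equality case of Hoelder's inequality. The witness is the sign at one coordinate of
  maximal modulus if p = 1, all the signs if p is infinite, and otherwise the signs times the
  normalised moduli to the power Q - 1.\<close>

lemma lp_norm_attained: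
  assumes p: "1 \<le> p" "1 / p + 1 / p' = 1" and n: "1 \<le> n"
  shows "\<exists>a\<in>vecs (lp_space p n). lp_norm p n a \<le> 1 \<and> (\<Sum>i<n. a i * b i) = lp_norm p' n b"
  using p
proof (cases rule: conjugate_exponent_cases)
  case 1
  have "lp_norm top n b \<in> (\<lambda>i. \<bar>b i\<bar>) ` {..<n}"
    unfolding lp_norm_top using n by (intro Max_in) (auto simp: lessThan_empty_iff)
  then obtain i where i: "i < n" "lp_norm top n b = \<bar>b i\<bar>" by auto
  define a where "a j = (if j = i then sgn (b i) else 0)" for j
  have "(\<Sum>j<n. \<bar>a j\<bar>) = \<bar>sgn (b i)\<bar>"
    using i by (subst sum.mono_neutral_right[of _ "{i}"]) (auto simp: a_def)
  moreover have "(\<Sum>j<n. a j * b j) = sgn (b i) * b i"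
    using i by (subst sum.mono_neutral_right[of _ "{i}"]) (auto simp: a_def)
  ultimately show ?thesis
    using 1 i by (intro bexI[of _ a]) (auto simp: lp_norm_one lp_space_def a_def abs_sgn_eq abs_sgn mult.commute)
next
  case 2
  define a where "a j = (if j < n then sgn (b j) else 0)" for j
  have "lp_norm top n a \<le> 1"
    unfolding lp_norm_top using n by (subst Max_le_iff) (auto simp: a_def abs_sgn_eq lessThan_empty_iff)
  moreover have "(\<Sum>j<n. a j * b j) = (\<Sum>j<n. \<bar>b j\<bar>)"
    by (intro sum.cong) (auto simp: a_def abs_sgn mult.commute)
  ultimately show ?thesis
    using 2 by (intro bexI[of _ a]) (auto simp: lp_norm_one lp_space_def a_def)
next
  case (3 P Q)
  define B where "B = lp_norm p' n b"
  have "0 \<le> B" using n by (simp add: B_def lp_norm_nonneg)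
  \<comment> \<open>This identity turns the P-th powers of the witness into normalised Q-th powers
    of \<open>b\<close>, which sum to 1.\<close>
  have conj: "(Q - 1) * P = Q"
    using 3 by (simp add: field_simps)
  show ?thesis
  proof (cases "B = 0")
    case True
    have "lp_norm p n (\<lambda>_. 0) = 0" using 3 by (simp add: lp_norm_real)
    then show ?thesis using True by (intro bexI[of _ "\<lambda>_. 0"]) (auto simp: lp_space_def B_def)
  next
    case False
    with \<open>0 \<le> B\<close> have B: "0 < B" by simp
    have BQ: "B powr Q = (\<Sum>i<n. \<bar>b i\<bar> powr Q)"
      using 3 by (simp add: B_def lp_norm_real_powr)
    define a where "a j = (if j < n then sgn (b j) * (\<bar>b j\<bar> / B) powr (Q - 1) else 0)" for j
    have "\<bar>a j\<bar> powr P = \<bar>b j\<bar> powr Q / B powr Q" if "j < n" for j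
    proof (cases "b j = 0")
      case True
      then show ?thesis using 3 by (simp add: a_def)
    next
      case False
      then show ?thesis
        using that B conj by (simp add: a_def abs_mult abs_sgn_eq powr_powr powr_divide)
    qed
    then have "(\<Sum>j<n. \<bar>a j\<bar> powr P) = B powr Q / B powr Q"
      unfolding BQ sum_divide_distrib by (intro sum.cong) auto
    then have "lp_norm p n a = 1"
      using 3 B by (simp add: lp_norm_real)
    moreover have "a j * b j = \<bar>b j\<bar> powr Q / B powr (Q - 1)" if "j < n" for j
    proof -
      have "a j * b j = \<bar>b j\<bar> * \<bar>b j\<bar> powr (Q - 1) / B powr (Q - 1)"
        using that B by (simp add: a_def powr_divide abs_sgn[of "b j"])
      also have "\<bar>b j\<bar> * \<bar>b j\<bar> powr (Q - 1) = \<bar>b j\<bar> powr Q"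
        by (simp add: powr_mult_base)
      finally show ?thesis .
    qed
    then have "(\<Sum>j<n. a j * b j) = B powr Q / B powr (Q - 1)"
      unfolding BQ sum_divide_distrib by (intro sum.cong) auto
    then have "(\<Sum>j<n. a j * b j) = B"
      using B by (simp flip: powr_diff)
    ultimately show ?thesis
      by (intro bexI[of _ a]) (auto simp: lp_space_def a_def B_def)
  qed
qed


section \<open>Linear maps and tensor products\<close>

lemma sum_fun_apply: "(\<Sum>k\<in>K. f k) x = (\<Sum>k\<in>K. f k x)"
  for f :: "'k \<Rightarrow> 'b \<Rightarrow> 'c::comm_monoid_add"
  by (induction K rule: infinite_finite_induct) auto

lemma linear_map_on_sum:
  assumes A: "subspace A" and T: "linear_map_on A T" and x: "\<And>k. k \<in> K \<Longrightarrow> x k \<in> A"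
  shows "T (\<Sum>k\<in>K. c k *\<^sub>R x k) = (\<Sum>k\<in>K. c k *\<^sub>R T (x k))"
proof -
  have "T 0 = 0"
    using T subspace_0[OF A] unfolding linear_map_on_def by (metis scaleR_zero_left)
  then show ?thesis
    using x
  proof (induction K rule: infinite_finite_induct)
    case (insert k K)
    have "(\<Sum>k\<in>K. c k *\<^sub>R x k) \<in> A"
      using insert by (auto intro!: subspace_sum[OF A] subspace_scale[OF A])
    moreover have "c k *\<^sub>R x k \<in> A"
      using insert by (auto intro!: subspace_scale[OF A])
    ultimately show ?case
      using insert T by (simp add: linear_map_on_def)
  qed auto
qed

lemma linear_map_on_zero: "subspace A \<Longrightarrow> linear_map_on A T \<Longrightarrow> T 0 = 0"
  using linear_map_on_sum[of A T "{}"] by simp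

lemma subspace_tens: "subspace A \<Longrightarrow> subspace (tens n A)"
  by (auto simp: subspace_def tens_def)

lemma vecs_lp_space: "a \<in> vecs (lp_space p n) \<longleftrightarrow> (\<forall>i\<ge>n. a i = 0)"
  and nrm_lp_space: "nrm (lp_space p n) = lp_norm p n"
  by (simp_all add: lp_space_def)

lemma subspace_lp_space: "subspace (vecs (lp_space p n))"
  by (auto simp: subspace_def vecs_lp_space)

lemma delta_in_lp_space: "j < n \<Longrightarrow> delta j \<in> vecs (lp_space p n)"
  by (simp add: vecs_lp_space delta_def)

lemma op_tens_id_apply: "op_tens_id n T w i = (\<Sum>j<n. T (delta j) i *\<^sub>R w j)"
  by (simp add: op_tens_id_def elem_tens_def sum_fun_apply)

lemma op_tens_id_in_tens:
  assumes T: "T \<in> bounded_ops (lp_space p n) (lp_space q m)" and A: "subspace A"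
    and w: "w \<in> tens n A"
  shows "op_tens_id n T w \<in> tens m A"
proof -
  have "T (delta j) \<in> vecs (lp_space q m)" if "j < n" for j
    using T delta_in_lp_space[OF that, of p] by (auto simp: bounded_ops_def)
  then have "T (delta j) i = 0" if "j < n" "m \<le> i" for i j
    using that by (auto simp: vecs_lp_space)
  then show ?thesis
    using w by (auto simp: tens_def op_tens_id_apply intro!: subspace_sum[OF A] subspace_scale[OF A])
qed

lemma op_norm_le:
  assumes "subspace (vecs E)" "nrm E 0 \<le> 1" "0 \<le> C"
    and le: "\<And>x. x \<in> vecs E \<Longrightarrow> nrm F (T x) \<le> C * nrm E x"
  shows "op_norm E F T \<le> C"
  unfolding op_norm_def
proof (rule cSup_least)
  show "{nrm F (T x) |x. x \<in> vecs E \<and> nrm E x \<le> 1} \<noteq> {}"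
    using assms(2) subspace_0[OF assms(1)] by blast
next
  fix y assume "y \<in> {nrm F (T x) |x. x \<in> vecs E \<and> nrm E x \<le> 1}"
  then obtain x where "y = nrm F (T x)" "x \<in> vecs E" "nrm E x \<le> 1" by blast
  then show "y \<le> C"
    using le[of x] mult_left_mono[of "nrm E x" 1 C] assms(3) by simp
qed

lemma lp_norm_zero: "1 \<le> p \<Longrightarrow> 1 \<le> n \<Longrightarrow> lp_norm p n 0 = 0"
  using lp_norm_scale[of p n 0 0] by (simp add: zero_fun_def)

lemma lp_op_norm_le:
  assumes "1 \<le> p" "1 \<le> n" "0 \<le> C"
    and "\<And>a. a \<in> vecs (lp_space p n) \<Longrightarrow> nrm F (T a) \<le> C * lp_norm p n a"
  shows "op_norm (lp_space p n) F T \<le> C"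
  using assms by (intro op_norm_le) (auto simp: subspace_lp_space nrm_lp_space lp_norm_zero)

lemma multinormed_subspace: "multinormed p X \<Longrightarrow> subspace (vecs X)"
  and multinormed_norm: "multinormed p X \<Longrightarrow> norm_on (vecs X) (nrm X)"
  and multinormed_mnorm: "multinormed p X \<Longrightarrow> 1 \<le> n \<Longrightarrow> norm_on (tens n (vecs X)) (mnrm X n)"
  and multinormed_cross: "multinormed p X \<Longrightarrow> 1 \<le> n \<Longrightarrow> a \<in> vecs (lp_space p n) \<Longrightarrow> x \<in> vecs X \<Longrightarrow>
    mnrm X n (elem_tens a x) = lp_norm p n a * nrm X x"
  by (simp_all add: multinormed_def banach_space_def nrm_lp_space)

text \<open>The operator axiom in the form used below: an explicit constant, checked on the carrier,
  stands in for the operator norm.\<close>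

lemma multinormed_op:
  assumes X: "multinormed p X" and p: "1 \<le> p" and mn: "1 \<le> m" "1 \<le> n" and C: "0 \<le> C"
    and vec: "\<And>a. a \<in> vecs (lp_space p n) \<Longrightarrow> T a \<in> vecs (lp_space p m)"
    and lin: "linear_map_on (vecs (lp_space p n)) T"
    and le: "\<And>a. a \<in> vecs (lp_space p n) \<Longrightarrow> lp_norm p m (T a) \<le> C * lp_norm p n a"
    and w: "w \<in> tens n (vecs X)"
  shows "op_tens_id n T w \<in> tens m (vecs X)" "mnrm X m (op_tens_id n T w) \<le> C * mnrm X n w"
proof -
  have T: "T \<in> bounded_ops (lp_space p n) (lp_space p m)"
    using vec lin le by (auto simp: bounded_ops_def nrm_lp_space)
  show "op_tens_id n T w \<in> tens m (vecs X)"
    by (rule op_tens_id_in_tens[OF T multinormed_subspace[OF X] w])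
  have "mnrm X m (op_tens_id n T w) \<le> op_norm (lp_space p n) (lp_space p m) T * mnrm X n w"
    using X mn T w by (simp add: multinormed_def)
  also have "\<dots> \<le> C * mnrm X n w"
    using w multinormed_mnorm[OF X mn(2)] p mn C le
    by (intro mult_right_mono lp_op_norm_le) (auto simp: nrm_lp_space norm_on_def)
  finally show "mnrm X m (op_tens_id n T w) \<le> C * mnrm X n w" .
qed

lemma delta_expansion:
  assumes "w \<in> tens n A"
  shows "w = (\<Sum>k<n. elem_tens (delta k) (w k))"
proof
  fix i
  have "(\<Sum>k<n. delta k i *\<^sub>R w k) = (\<Sum>k<n. if k = i then w k else 0)"
    by (intro sum.cong) (auto simp: delta_def)
  then show "w i = (\<Sum>k<n. elem_tens (delta k) (w k)) i"
    using assms by (auto simp: sum_fun_apply elem_tens_def tens_def sum.delta)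
qed

lemma lp_space_expansion:
  assumes "b \<in> vecs (lp_space p n)"
  shows "b = (\<Sum>j<n. b j *\<^sub>R delta j)"
proof
  fix i
  have "(\<Sum>j<n. b j * delta j i) = (\<Sum>j<n. if j = i then b j else 0)"
    by (intro sum.cong) (auto simp: delta_def)
  then show "b i = (\<Sum>j<n. b j *\<^sub>R delta j) i"
    using assms by (auto simp: sum_fun_apply vecs_lp_space sum.delta)
qed

lemma elem_tens_in_tens:
  "subspace A \<Longrightarrow> a \<in> vecs (lp_space p n) \<Longrightarrow> x \<in> A \<Longrightarrow> elem_tens a x \<in> tens n A"
  by (auto simp: tens_def elem_tens_def vecs_lp_space subspace_scale)

lemma elem_tens_sum: "elem_tens a (\<Sum>j\<in>K. c j *\<^sub>R x j) = (\<Sum>j\<in>K. c j *\<^sub>R elem_tens a (x j))"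
  by (auto simp: elem_tens_def fun_eq_iff sum_fun_apply scaleR_sum_right mult.commute)

lemma sum_lessThan_add: "(\<Sum>k<m + l. f k) = (\<Sum>k<m. f k) + (\<Sum>k<l. f (m + k))"
  for f :: "nat \<Rightarrow> 'c::comm_monoid_add"
  by (induction l) (simp_all add: add.assoc)


section \<open>The projective tensor norm\<close>

context
  fixes p q :: ennreal and n l :: nat
  assumes pq: "1 \<le> p" "1 \<le> q" and nl: "1 \<le> n" "1 \<le> l"
begin

lemma max_mn_le:
  fixes m :: nat
  assumes "\<And>k. k < m \<Longrightarrow> a k \<in> vecs (lp_space p n)" "\<And>k. k < m \<Longrightarrow> x k \<in> vecs (lp_space q l)"
  shows "mnrm (max_mn p (lp_space q l)) n (\<Sum>k<m. elem_tens (a k) (x k)) \<le>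
    (\<Sum>k<m. lp_norm p n (a k) * lp_norm q l (x k))"
  unfolding max_mn_def mnspace.simps nrm_lp_space
  using assms nl
  by (intro cInf_lower) (blast, auto intro!: bdd_belowI[of _ 0] sum_nonneg mult_nonneg_nonneg lp_norm_nonneg)

lemma max_mn_ge:
  assumes w: "w \<in> tens n (vecs (lp_space q l))"
    and le: "\<And>m a x. (\<And>k. k < m \<Longrightarrow> a k \<in> vecs (lp_space p n)) \<Longrightarrow>
      (\<And>k. k < m \<Longrightarrow> x k \<in> vecs (lp_space q l)) \<Longrightarrow> w = (\<Sum>k<m. elem_tens (a k) (x k)) \<Longrightarrow>
      c \<le> (\<Sum>k<(m::nat). lp_norm p n (a k) * lp_norm q l (x k))"
  shows "c \<le> mnrm (max_mn p (lp_space q l)) n w"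
  unfolding max_mn_def mnspace.simps nrm_lp_space
proof (rule cInf_greatest)
  \<comment> \<open>The expansion along the unit vectors is a representation of \<open>w\<close>, so
    the infimum is over a nonempty set.\<close>
  have "\<forall>k<n. delta k \<in> vecs (lp_space p n) \<and> w k \<in> vecs (lp_space q l)"
    using w delta_in_lp_space by (auto simp: tens_def)
  then show "{\<Sum>k<m. lp_norm p n (a k) * lp_norm q l (x k) |(m::nat) a x.
       (\<forall>k<m. a k \<in> vecs (lp_space p n) \<and> x k \<in> vecs (lp_space q l)) \<and>
       w = (\<Sum>k<m. elem_tens (a k) (x k))} \<noteq> {}"
    using delta_expansion[OF w] by blast
qed (use le in blast)

text \<open>Concatenating a representation of \<open>v\<close> with one of \<open>w\<close>
  represents the sum; the infima over the two are taken in turn.\<close>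

lemma max_mn_add:
  assumes v: "v \<in> tens n (vecs (lp_space q l))" and w: "w \<in> tens n (vecs (lp_space q l))"
  shows "mnrm (max_mn p (lp_space q l)) n (v + w) \<le>
    mnrm (max_mn p (lp_space q l)) n v + mnrm (max_mn p (lp_space q l)) n w"
proof -
  let ?N = "mnrm (max_mn p (lp_space q l)) n"
  have *: "?N (v + w) - (\<Sum>k<m. lp_norm p n (a k) * lp_norm q l (x k)) \<le> ?N w"
    if 1: "\<And>k. k < m \<Longrightarrow> a k \<in> vecs (lp_space p n)" "\<And>k. k < m \<Longrightarrow> x k \<in> vecs (lp_space q l)"
      "v = (\<Sum>k<m. elem_tens (a k) (x k))" for m :: nat and a x
  proof (rule max_mn_ge[OF w])
    fix m' :: nat and a' x'
    assume 2: "\<And>k. k < m' \<Longrightarrow> a' k \<in> vecs (lp_space p n)"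
      "\<And>k. k < m' \<Longrightarrow> x' k \<in> vecs (lp_space q l)" "w = (\<Sum>k<m'. elem_tens (a' k) (x' k))"
    define b y where "b k = (if k < m then a k else a' (k - m))"
      and "y k = (if k < m then x k else x' (k - m))" for k
    have eq: "(\<Sum>k<m + m'. elem_tens (b k) (y k)) = v + w"
      unfolding sum_lessThan_add 1(3) 2(3) by (simp add: b_def y_def)
    have "?N (v + w) \<le> (\<Sum>k<m + m'. lp_norm p n (b k) * lp_norm q l (y k))"
      unfolding eq[symmetric] using 1 2 by (intro max_mn_le) (auto simp: b_def y_def)
    also have "\<dots> = (\<Sum>k<m. lp_norm p n (a k) * lp_norm q l (x k)) +
        (\<Sum>k<m'. lp_norm p n (a' k) * lp_norm q l (x' k))"
      unfolding sum_lessThan_add by (simp add: b_def y_def)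
    finally show "?N (v + w) - (\<Sum>k<m. lp_norm p n (a k) * lp_norm q l (x k)) \<le>
        (\<Sum>k<m'. lp_norm p n (a' k) * lp_norm q l (x' k))"
      by linarith
  qed
  have "?N (v + w) - ?N w \<le> ?N v"
  proof (rule max_mn_ge[OF v])
    fix m :: nat and a x
    assume "\<And>k. k < m \<Longrightarrow> a k \<in> vecs (lp_space p n)" "\<And>k. k < m \<Longrightarrow> x k \<in> vecs (lp_space q l)"
      "v = (\<Sum>k<m. elem_tens (a k) (x k))"
    from *[OF this] show "?N (v + w) - ?N w \<le> (\<Sum>k<m. lp_norm p n (a k) * lp_norm q l (x k))"
      by linarith
  qed
  then show ?thesis by simp
qed

text \<open>Scaling the left factors of a representation of \<open>w\<close> yields one of the
  multiple. The same bound for \<open>inverse c\<close> later gives equality.\<close>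

lemma max_mn_scale_le:
  assumes w: "w \<in> tens n (vecs (lp_space q l))" and c: "c \<noteq> 0"
  shows "mnrm (max_mn p (lp_space q l)) n (c *\<^sub>R w) \<le> \<bar>c\<bar> * mnrm (max_mn p (lp_space q l)) n w"
proof -
  let ?N = "mnrm (max_mn p (lp_space q l)) n"
  have pos: "0 < \<bar>c\<bar>" using c by simp
  have "?N (c *\<^sub>R w) / \<bar>c\<bar> \<le> ?N w"
  proof (rule max_mn_ge[OF w])
    fix m :: nat and a x
    assume 1: "\<And>k. k < m \<Longrightarrow> a k \<in> vecs (lp_space p n)" "\<And>k. k < m \<Longrightarrow> x k \<in> vecs (lp_space q l)"
      "w = (\<Sum>k<m. elem_tens (a k) (x k))"
    have "?N (\<Sum>k<m. elem_tens (\<lambda>i. c * a k i) (x k)) \<le>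
        (\<Sum>k<m. lp_norm p n (\<lambda>i. c * a k i) * lp_norm q l (x k))"
      using 1 by (intro max_mn_le) (auto simp: vecs_lp_space)
    also have "\<dots> = \<bar>c\<bar> * (\<Sum>k<m. lp_norm p n (a k) * lp_norm q l (x k))"
      using pq nl by (simp add: lp_norm_scale sum_distrib_left mult.assoc)
    also have "(\<Sum>k<m. elem_tens (\<lambda>i. c * a k i) (x k)) = c *\<^sub>R w"
      by (simp add: 1(3) fun_eq_iff elem_tens_def sum_fun_apply sum_distrib_left mult.assoc)
    finally show "?N (c *\<^sub>R w) / \<bar>c\<bar> \<le> (\<Sum>k<m. lp_norm p n (a k) * lp_norm q l (x k))"
      unfolding pos_divide_le_eq[OF pos] by (simp only: mult.commute)
  qed
  then show ?thesis unfolding pos_divide_le_eq[OF pos] by (simp only: mult.commute)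
qed

lemma max_mn_zero: "mnrm (max_mn p (lp_space q l)) n 0 = 0"
proof (rule antisym)
  show "mnrm (max_mn p (lp_space q l)) n 0 \<le> 0"
    using max_mn_le[of 0] by simp
  show "0 \<le> mnrm (max_mn p (lp_space q l)) n 0"
    using nl subspace_0[OF subspace_tens[OF subspace_lp_space]]
    by (intro max_mn_ge) (auto intro!: sum_nonneg mult_nonneg_nonneg lp_norm_nonneg)
qed

lemma max_mn_scale:
  assumes w: "w \<in> tens n (vecs (lp_space q l))"
  shows "mnrm (max_mn p (lp_space q l)) n (c *\<^sub>R w) = \<bar>c\<bar> * mnrm (max_mn p (lp_space q l)) n w"
proof (cases "c = 0")
  case True
  then show ?thesis by (simp add: max_mn_zero)
next
  case False
  let ?N = "mnrm (max_mn p (lp_space q l)) n"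
  have "c *\<^sub>R w \<in> tens n (vecs (lp_space q l))"
    using w by (intro subspace_scale subspace_tens subspace_lp_space)
  from max_mn_scale_le[OF this, of "inverse c"] False
  have "?N w \<le> inverse \<bar>c\<bar> * ?N (c *\<^sub>R w)" by (simp add: abs_inverse)
  from mult_left_mono[OF this, of "\<bar>c\<bar>"] False
  have "\<bar>c\<bar> * ?N w \<le> ?N (c *\<^sub>R w)" by (simp flip: mult.assoc)
  with max_mn_scale_le[OF w False] show ?thesis by (rule antisym)
qed

text \<open>Hahn--Banach for the projective norm. A single elementary tensor is its own one-term
  representation, so the functional is a bilinear form of norm at most 1 on the two factors.\<close>

lemma max_mn_norming:
  assumes w: "w \<in> tens n (vecs (lp_space q l))"
  shows "\<exists>g. linear g \<and> g w = mnrm (max_mn p (lp_space q l)) n w \<and>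
    (\<forall>a\<in>vecs (lp_space p n). \<forall>b\<in>vecs (lp_space q l).
      \<bar>g (elem_tens a b)\<bar> \<le> lp_norm p n a * lp_norm q l b)"
proof -
  obtain g where g: "linear g" "\<forall>v\<in>tens n (vecs (lp_space q l)). \<bar>g v\<bar> \<le> mnrm (max_mn p (lp_space q l)) n v"
    "g w = mnrm (max_mn p (lp_space q l)) n w"
    using norming_functional[OF subspace_tens[OF subspace_lp_space] w, of "mnrm (max_mn p (lp_space q l)) n"]
      max_mn_add max_mn_scale by blast
  have "\<bar>g (elem_tens a b)\<bar> \<le> lp_norm p n a * lp_norm q l b"
    if "a \<in> vecs (lp_space p n)" "b \<in> vecs (lp_space q l)" for a b
  proof -
    have "\<bar>g (elem_tens a b)\<bar> \<le> mnrm (max_mn p (lp_space q l)) n (elem_tens a b)"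
      using g(2) elem_tens_in_tens[OF subspace_lp_space that] by blast
    also have "\<dots> \<le> lp_norm p n a * lp_norm q l b"
      using max_mn_le[of "Suc 0" "\<lambda>_. a" "\<lambda>_. b"] that by simp
    finally show ?thesis .
  qed
  with g show ?thesis by blast
qed

end

section \<open>The embedding given by a norming family of functionals\<close>

lemma trace_le_max_mn:
  assumes p: "1 \<le> p" "1 / p + 1 / p' = 1" and n: "1 \<le> n"
    and w: "w \<in> tens n (vecs (lp_space p' n))"
  shows "(\<Sum>j<n. w j j) \<le> mnrm (max_mn p (lp_space p' n)) n w"
proof (rule max_mn_ge[OF p(1) conjugate_exponent_sym(1)[OF p] n n w])
  fix m a x assume w: "w = (\<Sum>k<m. elem_tens (a k) (x k))"
  \<comment> \<open>The trace of an elementary tensor is the duality pairing of its factors, so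
    Hoelder's inequality bounds it term by term.\<close>
  have "(\<Sum>j<n. w j j) = (\<Sum>j<n. \<Sum>k<m. a k j * x k j)"
    by (simp add: w sum_fun_apply elem_tens_def)
  also have "\<dots> = (\<Sum>k<m. \<Sum>j<n. a k j * x k j)"
    by (rule sum.swap)
  also have "\<dots> \<le> (\<Sum>k<m. lp_norm p n (a k) * lp_norm p' n (x k))"
    by (intro sum_mono order_trans[OF abs_ge_self holder_sum[OF p n]])
  finally show "(\<Sum>j<n. w j j) \<le> (\<Sum>k<m. lp_norm p n (a k) * lp_norm p' n (x k))" .
qed

text \<open>A norming bilinear form \<open>g\<close> for the image of \<open>z\<close> corresponds
  to a contraction \<open>S\<close> from \<open>lp_space p n\<close> to \<open>lp_space p l\<close>,
  and its value there is the functional (f j) at (S \<otimes> I) z. The operator axiom and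
  \<open>ball\<close> bound this by the norm of \<open>z\<close>.\<close>

lemma max_mn_contraction:
  assumes p: "1 \<le> p" "1 / p + 1 / p' = 1" and nl: "1 \<le> n" "1 \<le> l"
    and X: "multinormed p X"
    and lin: "\<And>j. j < l \<Longrightarrow> linear_map_on (vecs X) (f j)"
    and ball: "\<And>z. z \<in> tens l (vecs X) \<Longrightarrow> (\<Sum>j<l. f j (z j)) \<le> mnrm X l z"
    and z: "z \<in> tens n (vecs X)"
  shows "mnrm (max_mn p (lp_space p' l)) n (\<lambda>k j. if j < l then f j (z k) else 0) \<le> mnrm X n z"
proof -
  note p' = conjugate_exponent_sym[OF p]
  note A = multinormed_subspace[OF X]
  define w where "w k j = (if j < l then f j (z k) else 0)" for k j
  have w: "w \<in> tens n (vecs (lp_space p' l))"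
    using z linear_map_on_zero[OF A lin] by (auto simp: tens_def w_def vecs_lp_space fun_eq_iff)
  obtain g where g: "linear g" "g w = mnrm (max_mn p (lp_space p' l)) n w"
    and g_le: "\<And>a b. a \<in> vecs (lp_space p n) \<Longrightarrow> b \<in> vecs (lp_space p' l) \<Longrightarrow>
      \<bar>g (elem_tens a b)\<bar> \<le> lp_norm p n a * lp_norm p' l b"
    using max_mn_norming[OF p(1) p'(1) nl w] by blast
  \<comment> \<open>\<open>S a\<close> represents the functional b \<mapsto> g (a \<otimes> b) by
    its values at the unit vectors; the padding by 0 puts it into the carrier.\<close>
  define S where "S a j = (if j < l then g (elem_tens a (delta j)) else 0)" for a j
  have g_elem: "g (elem_tens a b) = (\<Sum>j<l. b j * S a j)" if "b \<in> vecs (lp_space p' l)" for a b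
  proof -
    have "elem_tens a b = (\<Sum>j<l. b j *\<^sub>R elem_tens a (delta j))"
      using lp_space_expansion[OF that] elem_tens_sum[of a b delta "{..<l}"] by simp
    then show ?thesis
      by (simp add: linear_sum[OF g(1)] linear_scale[OF g(1)] S_def)
  qed
  have S_vec: "S a \<in> vecs (lp_space p l)" for a
    by (simp add: S_def vecs_lp_space)
  have "elem_tens (a + b) c = elem_tens a c + elem_tens b c"
    "elem_tens (r *\<^sub>R a) c = r *\<^sub>R elem_tens a c" for a b r and c :: "nat \<Rightarrow> real"
    by (auto simp: elem_tens_def fun_eq_iff algebra_simps)
  then have S_lin: "linear_map_on (vecs (lp_space p n)) S"
    unfolding linear_map_on_def S_def
    by (auto simp: linear_add[OF g(1)] linear_scale[OF g(1)])
  have S_le: "lp_norm p l (S a) \<le> 1 * lp_norm p n a" if a: "a \<in> vecs (lp_space p n)" for a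
  proof -
    \<comment> \<open>The roles of \<open>p\<close> and \<open>p'\<close> are exchanged here: a
      norming vector for \<open>S a\<close> lies in the unit ball of \<open>lp_space p' l\<close>,
      where \<open>g\<close> is controlled.\<close>
    obtain b where b: "b \<in> vecs (lp_space p' l)" "lp_norm p' l b \<le> 1"
      "(\<Sum>j<l. b j * S a j) = lp_norm p l (S a)"
      using lp_norm_attained[OF p' nl(2), of "S a"] by blast
    have "lp_norm p l (S a) \<le> lp_norm p n a * lp_norm p' l b"
      using g_le[OF a b(1)] b(3) by (simp add: g_elem[OF b(1)])
    also have "\<dots> \<le> lp_norm p n a * 1"
      using b nl by (intro mult_left_mono) (auto intro: lp_norm_nonneg)
    finally show ?thesis by simp
  qed
  note Sz = multinormed_op[OF X p(1) nl(2,1) zero_le_one S_vec S_lin S_le z]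
  have "g w = (\<Sum>k<n. g (elem_tens (delta k) (w k)))"
    using delta_expansion[OF w] linear_sum[OF g(1)] by metis
  also have "\<dots> = (\<Sum>k<n. \<Sum>j<l. w k j * S (delta k) j)"
    using w by (intro sum.cong g_elem) (auto simp: tens_def)
  \<comment> \<open>Exchanging the sums moves \<open>S\<close> from the pairing onto
    \<open>z\<close>.\<close>
  also have "\<dots> = (\<Sum>j<l. \<Sum>k<n. S (delta k) j *\<^sub>R f j (z k))"
    by (subst sum.swap) (simp add: w_def mult.commute)
  also have "\<dots> = (\<Sum>j<l. f j (op_tens_id n S z j))"
    unfolding op_tens_id_apply using z
    by (intro sum.cong linear_map_on_sum[OF A lin, symmetric]) (auto simp: tens_def)
  also have "\<dots> \<le> mnrm X n z"
    using ball[OF Sz(1)] Sz(2) by simp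
  finally have "g w \<le> mnrm X n z" .
  moreover have "(\<lambda>k j. if j < l then f j (z k) else 0) = w"
    by (simp add: w_def fun_eq_iff)
  ultimately show ?thesis by (simp only: g(2))
qed

text \<open>Pairing (f j x) with a norming vector \<open>a\<close> amounts to evaluating the
  functional at a \<otimes> x, whose norm is a product by the cross-norm axiom. This bound puts the
  image of \<open>x\<close> into the \<ell>-infinity sum.\<close>

lemma dual_ball_lp_norm_le:
  assumes p: "1 \<le> p" "1 / p + 1 / p' = 1" and l: "1 \<le> l" and X: "multinormed p X"
    and lin: "\<And>j. j < l \<Longrightarrow> linear_map_on (vecs X) (f j)"
    and ball: "\<And>z. z \<in> tens l (vecs X) \<Longrightarrow> (\<Sum>j<l. f j (z j)) \<le> mnrm X l z"
    and x: "x \<in> vecs X"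
  shows "lp_norm p' l (\<lambda>j. if j < l then f j x else 0) \<le> nrm X x"
proof -
  obtain a where a: "a \<in> vecs (lp_space p l)" "lp_norm p l a \<le> 1"
    "(\<Sum>j<l. a j * (if j < l then f j x else 0)) = lp_norm p' l (\<lambda>j. if j < l then f j x else 0)"
    using lp_norm_attained[OF p l, of "\<lambda>j. if j < l then f j x else 0"] by blast
  have "f j (elem_tens a x j) = a j * (if j < l then f j x else 0)" if "j < l" for j
    using lin[OF that] x that by (simp add: linear_map_on_def elem_tens_def)
  then have "lp_norm p' l (\<lambda>j. if j < l then f j x else 0) = (\<Sum>j<l. f j (elem_tens a x j))"
    unfolding a(3)[symmetric] by (intro sum.cong) auto
  also have "\<dots> \<le> lp_norm p l a * nrm X x"
    using ball[OF elem_tens_in_tens[OF multinormed_subspace[OF X] a(1) x]]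
    by (simp add: multinormed_cross[OF X l a(1) x])
  also have "\<dots> \<le> 1 * nrm X x"
    using a x multinormed_norm[OF X] by (intro mult_right_mono) (auto simp: norm_on_def)
  finally show ?thesis by simp
qed

text \<open>Each coordinate is contractive by \<open>max_mn_contraction\<close>; the trace at an
  almost norming index gives the reverse bound. The slack \<open>e\<close> allows for dual spaces,
  where the norm is given as a supremum over the unit ball of the predual.\<close>

lemma norming_family_embedding:
  assumes p: "1 \<le> p" "1 / p + 1 / p' = 1" and X: "multinormed p X"
    and N: "\<And>i. i \<in> I \<Longrightarrow> 1 \<le> N i"
    and lin: "\<And>i j. i \<in> I \<Longrightarrow> j < N i \<Longrightarrow> linear_map_on (vecs X) (f i j)"
    and ball: "\<And>i z. i \<in> I \<Longrightarrow> z \<in> tens (N i) (vecs X) \<Longrightarrow> (\<Sum>j<N i. f i j (z j)) \<le> mnrm X (N i) z"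
    and norming: "\<And>n z e. 1 \<le> n \<Longrightarrow> z \<in> tens n (vecs X) \<Longrightarrow> 0 < e \<Longrightarrow>
      \<exists>i\<in>I. N i = n \<and> mnrm X n z - e \<le> (\<Sum>j<n. f i j (z j))"
  shows "multiisometric_embedding X (max_sum p p' I N)
    (\<lambda>x i j. if i \<in> I \<and> j < N i then f i j x else 0)"
    (is "multiisometric_embedding X ?Y ?u")
  unfolding multiisometric_embedding_def
proof (intro conjI allI impI ballI subsetI)
  fix y assume "y \<in> ?u ` vecs X"
  then obtain x where x: "x \<in> vecs X" and y: "y = ?u x" by blast
  have "lp_norm p' (N i) (?u x i) \<le> nrm X x" if "i \<in> I" for i
    using dual_ball_lp_norm_le[OF p N X lin ball x] that by simp
  then show "y \<in> vecs ?Y"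
    unfolding y
    by (auto simp: max_sum_def linf_sum_def max_mn_def vecs_lp_space nrm_lp_space fun_eq_iff
        intro!: bdd_aboveI[of _ "nrm X x"])
next
  show "linear_map_on (vecs X) ?u"
    using lin by (auto simp: linear_map_on_def fun_eq_iff)
next
  fix n z assume n: "1 \<le> (n::nat)" and z: "z \<in> tens n (vecs X)"
  define h where "h i = mnrm (max_mn p (lp_space p' (N i))) n (\<lambda>k. ?u (z k) i)" for i
  have mn: "mnrm ?Y n (\<lambda>k. ?u (z k)) = Sup (insert 0 (h ` I))"
    by (simp add: max_sum_def linf_sum_def h_def)
  have upper: "h i \<le> mnrm X n z" if "i \<in> I" for i
    using max_mn_contraction[OF p n N X lin ball z] that by (simp add: h_def)
  have nn: "0 \<le> mnrm X n z"
    using multinormed_mnorm[OF X n] z by (simp add: norm_on_def)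
  show "mnrm ?Y n (\<lambda>k. ?u (z k)) = mnrm X n z"
  proof (rule antisym)
    show "mnrm ?Y n (\<lambda>k. ?u (z k)) \<le> mnrm X n z"
      unfolding mn using upper nn by (intro cSup_least) auto
    show "mnrm X n z \<le> mnrm ?Y n (\<lambda>k. ?u (z k))"
    proof (rule field_le_epsilon)
      fix e :: real assume "0 < e"
      then obtain i where i: "i \<in> I" "N i = n" and le: "mnrm X n z - e \<le> (\<Sum>j<n. f i j (z j))"
        using norming[OF n z] by blast
      \<comment> \<open>Since \<open>N i = n\<close>, this coordinate is a square array, whose
        diagonal entries are the \<open>f i j (z j)\<close>.\<close>
      have "(\<lambda>k. ?u (z k) i) \<in> tens n (vecs (lp_space p' n))"
        using z i linear_map_on_zero[OF multinormed_subspace[OF X] lin]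
        by (auto simp: tens_def vecs_lp_space fun_eq_iff)
      from trace_le_max_mn[OF p n this] i have "(\<Sum>j<n. f i j (z j)) \<le> h i"
        by (simp add: h_def)
      also have "\<dots> \<le> Sup (insert 0 (h ` I))"
        using i upper nn by (intro cSup_upper) (auto intro!: bdd_aboveI[of _ "mnrm X n z"])
      finally show "mnrm X n z \<le> mnrm ?Y n (\<lambda>k. ?u (z k)) + e"
        using le by (simp add: mn)
    qed
  qed
qed


section \<open>Absolutely convergent sums and duality\<close>

lemma banach_sum_exists:
  assumes E: "banach_space E" and d: "\<And>k. d k \<in> vecs E" and s: "summable (\<lambda>k. nrm E (d k))"
  shows "\<exists>x\<in>vecs E. (\<lambda>m. nrm E ((\<Sum>k<m. d k) - x)) \<longlonglongrightarrow> 0"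
proof -
  have A: "subspace (vecs E)" and N: "norm_on (vecs E) (nrm E)"
    and complete: "\<And>s :: nat \<Rightarrow> 'a. (\<And>k. s k \<in> vecs E) \<Longrightarrow>
         (\<forall>e>0. \<exists>M. \<forall>j\<ge>M. \<forall>k\<ge>M. nrm E (s j - s k) < e) \<Longrightarrow>
         \<exists>x\<in>vecs E. (\<lambda>k. nrm E (s k - x)) \<longlonglongrightarrow> 0"
    using E by (auto simp: banach_space_def)
  have N0: "nrm E 0 = 0" and nn: "\<And>x. x \<in> vecs E \<Longrightarrow> 0 \<le> nrm E x"
    and add: "\<And>x y. x \<in> vecs E \<Longrightarrow> y \<in> vecs E \<Longrightarrow> nrm E (x + y) \<le> nrm E x + nrm E y"
    and scale: "\<And>c x. x \<in> vecs E \<Longrightarrow> nrm E (c *\<^sub>R x) = \<bar>c\<bar> * nrm E x"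
    using N subspace_0[OF A] by (auto simp: norm_on_def)
  have t: "(\<Sum>k\<in>K. d k) \<in> vecs E" for K
    using d by (intro subspace_sum A)
  have sum_le: "nrm E (\<Sum>k\<in>K. d k) \<le> (\<Sum>k\<in>K. nrm E (d k))" for K
  proof (induction K rule: infinite_finite_induct)
    case (insert k K)
    then show ?case using add[OF d t, of k K] by simp
  qed (simp_all add: N0)
  have diff: "nrm E ((\<Sum>k<i. d k) - (\<Sum>k<j. d k)) \<le> (\<Sum>k=j..<i. nrm E (d k))" if "j \<le> i" for i j
  proof -
    have "(\<Sum>k<j. d k) + (\<Sum>k=j..<i. d k) = (\<Sum>k<i. d k)"
      using sum.atLeastLessThan_concat[of 0 j i d] that by (simp add: atLeast0LessThan)
    then have "(\<Sum>k<i. d k) - (\<Sum>k<j. d k) = (\<Sum>k=j..<i. d k)"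
      by (metis add_diff_cancel_left')
    then show ?thesis using sum_le by simp
  qed
  show ?thesis
  proof (rule complete[OF t], intro allI impI)
    fix e :: real assume "0 < e"
    then obtain M where M: "\<And>m n. M \<le> m \<Longrightarrow> norm (\<Sum>k=m..<n. nrm E (d k)) < e"
      using s unfolding summable_Cauchy by blast
    have lt: "nrm E ((\<Sum>k<i. d k) - (\<Sum>k<j. d k)) < e" if "M \<le> j" "j \<le> i" for i j
      using diff[OF that(2)] M[OF that(1), of i] by simp
    \<comment> \<open>The block estimate covers \<open>j \<le> i\<close> only; the other order
      follows by changing the sign.\<close>
    have "nrm E ((\<Sum>k<i. d k) - (\<Sum>k<j. d k)) < e" if "M \<le> i" "M \<le> j" for i j
    proof (cases "j \<le> i")
      case False
      then show ?thesis
        using lt[of i j] that scale[OF subspace_diff[OF A t t], of "- 1" "{..<j}" "{..<i}"] by simp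
    qed (use lt that in blast)
    then show "\<exists>M. \<forall>j\<ge>M. \<forall>k\<ge>M. nrm E ((\<Sum>k<j. d k) - (\<Sum>ka<k. d ka)) < e"
      by blast
  qed
qed

text \<open>The sum of an absolutely summable family, tested against bounded functionals; only countably
  many terms are nonzero, which reduces it to a series.\<close>

lemma banach_infsum_exists:
  assumes E: "banach_space E" and c: "\<And>i. i \<in> I \<Longrightarrow> c i \<in> vecs E"
    and s: "(\<lambda>i. nrm E (c i)) summable_on I"
  shows "\<exists>x\<in>vecs E. \<forall>\<phi> C. linear_map_on (vecs E) \<phi> \<longrightarrow> (\<forall>v\<in>vecs E. \<bar>\<phi> v\<bar> \<le> C * nrm E v) \<longrightarrow>
    \<phi> x = (\<Sum>\<^sub>\<infinity>i\<in>I. \<phi> (c i) :: real)"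
proof -
  have A: "subspace (vecs E)" and N: "norm_on (vecs E) (nrm E)"
    using E by (auto simp: banach_space_def)
  have N0: "nrm E 0 = 0" and nn: "\<And>x. x \<in> vecs E \<Longrightarrow> 0 \<le> nrm E x"
    and eq0: "\<And>x. x \<in> vecs E \<Longrightarrow> nrm E x = 0 \<Longrightarrow> x = 0"
    using N subspace_0[OF A] by (auto simp: norm_on_def)
  define J where "J = {i\<in>I. nrm E (c i) \<noteq> 0}"
  \<comment> \<open>The nonzero terms are moved to their codes \<open>K\<close> in the naturals.
    Setting \<open>d\<close> to 0 at all other numbers gives one series whether the support is
    finite or infinite.\<close>
  define K where "K = to_nat_on J ` J"
  define d where "d k = (if k \<in> K then c (from_nat_into J k) else 0)" for k
  have J: "countable J" unfolding J_def by (rule summable_countable_real[OF s])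
  have d_J: "d (to_nat_on J i) = c i" if "i \<in> J" for i
    using that J by (simp add: d_def K_def)
  have inj: "inj_on (to_nat_on J) J" by (rule inj_on_to_nat_on[OF J])
  have d: "d k \<in> vecs E" for k
    using J c subspace_0[OF A] by (auto simp: d_def K_def J_def)
  have reindex: "(\<Sum>\<^sub>\<infinity>i\<in>I. g (c i)) = (\<Sum>\<^sub>\<infinity>k. g (d k))" if "g 0 = 0" for g :: "'a \<Rightarrow> real"
  proof -
    have "(\<Sum>\<^sub>\<infinity>i\<in>I. g (c i)) = (\<Sum>\<^sub>\<infinity>i\<in>J. g (c i))"
    proof (rule infsum_cong_neutral)
      fix i assume "i \<in> I - J"
      then have "c i = 0" using c eq0 by (auto simp: J_def)
      then show "g (c i) = 0" using that by simp
    qed (auto simp: J_def)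
    also have "\<dots> = (\<Sum>\<^sub>\<infinity>i\<in>J. ((\<lambda>k. g (d k)) \<circ> to_nat_on J) i)"
      using d_J by (intro infsum_cong) simp
    also have "\<dots> = (\<Sum>\<^sub>\<infinity>k\<in>K. g (d k))"
      unfolding K_def by (rule infsum_reindex[OF inj, symmetric])
    also have "\<dots> = (\<Sum>\<^sub>\<infinity>k. g (d k))"
      using that by (intro infsum_cong_neutral) (auto simp: d_def)
    finally show ?thesis .
  qed
  have "(\<lambda>i. nrm E (c i)) summable_on J"
    by (rule summable_on_cong_neutral[THEN iffD1, OF _ _ _ s]) (auto simp: J_def)
  then have "((\<lambda>k. nrm E (d k)) \<circ> to_nat_on J) summable_on J"
    using d_J by (simp cong: summable_on_cong)
  then have "(\<lambda>k. nrm E (d k)) summable_on K"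
    unfolding K_def by (simp add: summable_on_reindex[OF inj])
  then have "(\<lambda>k. nrm E (d k)) summable_on UNIV"
    by (subst summable_on_cong_neutral[of K UNIV _ "\<lambda>k. nrm E (d k)"]) (auto simp: d_def N0)
  then have sd: "summable (\<lambda>k. nrm E (d k))"
    using d nn by (simp add: summable_on_UNIV_nonneg_real_iff)
  obtain x where x: "x \<in> vecs E" "(\<lambda>m. nrm E ((\<Sum>k<m. d k) - x)) \<longlonglongrightarrow> 0"
    using banach_sum_exists[OF E d sd] by blast
  have "\<phi> x = (\<Sum>\<^sub>\<infinity>i\<in>I. \<phi> (c i))"
    if lin: "linear_map_on (vecs E) \<phi>" and le: "\<forall>v\<in>vecs E. \<bar>\<phi> v\<bar> \<le> C * nrm E v" for \<phi> :: "'a \<Rightarrow> real" and C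
  proof -
    have part: "(\<Sum>k<m. d k) \<in> vecs E" for m using d by (intro subspace_sum A)
    have "(\<Sum>k<m. \<phi> (d k)) - \<phi> x = \<phi> ((\<Sum>k<m. d k) - x)" for m
    proof -
      have "\<phi> ((\<Sum>k<m. d k) + (-1) *\<^sub>R x) = \<phi> (\<Sum>k<m. d k) + (-1) *\<^sub>R \<phi> x"
        using lin part x subspace_scale[OF A x(1), of "-1"] unfolding linear_map_on_def by metis
      moreover have "\<phi> (\<Sum>k<m. d k) = (\<Sum>k<m. \<phi> (d k))"
        using linear_map_on_sum[where c = "\<lambda>_. 1" and K = "{..<m}", OF A lin d] by simp
      ultimately show ?thesis by simp
    qed
    then have "(\<lambda>m. (\<Sum>k<m. \<phi> (d k)) - \<phi> x) \<longlonglongrightarrow> 0"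
      using le subspace_diff[OF A part x(1)]
      by (intro Lim_null_comparison[OF always_eventually tendsto_mult_right_zero[OF x(2), of C]]) simp
    then have "(\<lambda>k. \<phi> (d k)) sums \<phi> x"
      unfolding sums_def by (simp add: LIM_zero_iff)
    \<comment> \<open>Absolute summability upgrades the ordered series to an unordered sum, which
      can be carried back to \<open>I\<close>.\<close>
    moreover have "summable (\<lambda>k. norm (\<phi> (d k)))"
      using le d by (intro summable_comparison_test'[OF summable_mult[OF sd, of C], of 0]) simp
    ultimately have "((\<lambda>k. \<phi> (d k)) has_sum \<phi> x) UNIV"
      by (rule norm_summable_imp_has_sum[rotated])
    then show ?thesis
      using reindex[of \<phi>] linear_map_on_zero[OF A lin] by (simp add: infsumI)
  qed
  with x show ?thesis by blast
qed

lemma lp_norm_Suc_0: "1 \<le> p \<Longrightarrow> lp_norm p (Suc 0) a = \<bar>a 0\<bar>"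
proof (cases p)
  case (real P)
  assume "1 \<le> p"
  with real show ?thesis by (simp add: lp_norm_real powr_powr)
qed (simp add: lp_norm_def lessThan_Suc)

text \<open>The coefficients \<open>y\<close> define an operator from \<open>lp_space p' n\<close>
  to the one-dimensional space, of norm at most \<open>lp_norm p n y\<close> by Hoelder. The
  operator axiom applies to it, and the cross-norm axiom identifies the one-dimensional tensor
  product with \<open>V\<close>.\<close>

lemma multinormed_combination_le:
  assumes p: "1 \<le> p" "1 / p + 1 / p' = 1" and n: "1 \<le> n" and V: "multinormed p' V"
    and v: "v \<in> tens n (vecs V)"
  shows "nrm V (\<Sum>j<n. y j *\<^sub>R v j) \<le> lp_norm p n y * mnrm V n v"
proof -
  note p' = conjugate_exponent_sym[OF p]
  define T where "T a i = (if i = (0::nat) then (\<Sum>j<n. y j * a j) else 0)" for a i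
  have vec: "T a \<in> vecs (lp_space p' 1)" for a
    by (simp add: T_def vecs_lp_space)
  have lin: "linear_map_on (vecs (lp_space p' n)) T"
    by (auto simp: linear_map_on_def T_def fun_eq_iff algebra_simps sum.distrib sum_distrib_left)
  have le: "lp_norm p' 1 (T a) \<le> lp_norm p n y * lp_norm p' n a" for a
    using holder_sum[OF p n, of y a] by (simp add: lp_norm_Suc_0[OF p'(1)] T_def)
  have "mnrm V 1 (op_tens_id n T v) \<le> lp_norm p n y * mnrm V n v"
    using multinormed_op[OF V p'(1) _ n lp_norm_nonneg[OF n] vec lin le v] by simp
  moreover have "op_tens_id n T v = elem_tens (delta 0) (\<Sum>j<n. y j *\<^sub>R v j)"
  proof
    fix i
    have "T (delta j) i = (if i = 0 then y j else 0)" if "j < n" for j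
    proof -
      have "(\<Sum>k<n. y k * delta j k) = (\<Sum>k<n. if k = j then y k else 0)"
        by (intro sum.cong) (auto simp: delta_def)
      then show ?thesis using that by (simp add: T_def sum.delta)
    qed
    then show "op_tens_id n T v i = elem_tens (delta 0) (\<Sum>j<n. y j *\<^sub>R v j) i"
      by (simp add: op_tens_id_apply elem_tens_def delta_def)
  qed
  moreover have "(\<Sum>j<n. y j *\<^sub>R v j) \<in> vecs V"
    using v multinormed_subspace[OF V] by (auto simp: tens_def intro!: subspace_sum subspace_scale)
  ultimately show ?thesis
    using multinormed_cross[OF V, of 1 "delta 0"] delta_in_lp_space[of 0 1 p']
    by (simp add: lp_norm_Suc_0[OF p'(1)] delta_def)
qed

lemma bdual_functional:
  assumes "\<phi> \<in> vecs (bdual V)"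
  shows "linear_map_on (vecs V) \<phi>" "\<exists>C. \<forall>v\<in>vecs V. \<bar>\<phi> v\<bar> \<le> C * nrm V v"
  using assms by (auto simp: bdual_def bounded_ops_def real_space_def)

context
  fixes p p' :: ennreal and V :: "'v::real_vector mnspace"
  assumes p: "1 \<le> p" "1 / p + 1 / p' = 1" and V: "multinormed p' V"
begin

text \<open>Needed for the supremum in \<open>mdual\<close> to dominate its members. The i-th entry
  of \<open>w\<close> is the combination with coefficients \<open>delta i\<close>, hence bounded
  over the unit ball, and each \<open>g i\<close> is a bounded functional.\<close>

lemma mdual_bdd_above:
  assumes n: "1 \<le> n" and g: "\<And>i. i < n \<Longrightarrow> g i \<in> vecs (bdual V)"
  shows "bdd_above {\<bar>\<Sum>i<n. g i (w i)\<bar> |w. w \<in> tens n (vecs V) \<and> mnrm V n w \<le> 1}"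
proof -
  have "\<exists>C. \<forall>i<n. \<forall>v\<in>vecs V. \<bar>g i v\<bar> \<le> C i * nrm V v"
    using bdual_functional(2)[OF g] by metis
  then obtain C where C: "\<And>i v. i < n \<Longrightarrow> v \<in> vecs V \<Longrightarrow> \<bar>g i v\<bar> \<le> C i * nrm V v"
    by blast
  have "\<bar>\<Sum>i<n. g i (w i)\<bar> \<le> (\<Sum>i<n. \<bar>C i\<bar> * lp_norm p n (delta i))"
    if w: "w \<in> tens n (vecs V)" "mnrm V n w \<le> 1" for w
  proof (rule order_trans[OF sum_abs sum_mono])
    fix i assume "i \<in> {..<n}"
    then have i: "i < n" "w i \<in> vecs V" using w by (auto simp: tens_def)
    have nn: "0 \<le> nrm V (w i)" using multinormed_norm[OF V] i by (auto simp: norm_on_def)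
    have "(\<Sum>j<n. delta i j *\<^sub>R w j) = (\<Sum>j<n. if j = i then w j else 0)"
      by (intro sum.cong) (auto simp: delta_def)
    then have "(\<Sum>j<n. delta i j *\<^sub>R w j) = w i"
      using i by (simp add: sum.delta)
    then have "nrm V (w i) \<le> lp_norm p n (delta i) * mnrm V n w"
      using multinormed_combination_le[OF p n V w(1), of "delta i"] by simp
    also have "\<dots> \<le> lp_norm p n (delta i) * 1"
      using w by (intro mult_left_mono lp_norm_nonneg n)
    finally have "nrm V (w i) \<le> lp_norm p n (delta i)" by simp
    have "\<bar>g i (w i)\<bar> \<le> C i * nrm V (w i)" using C i by blast
    also have "\<dots> \<le> \<bar>C i\<bar> * nrm V (w i)" using nn by (intro mult_right_mono) auto
    also have "\<dots> \<le> \<bar>C i\<bar> * lp_norm p n (delta i)"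
      by (intro mult_left_mono) (fact | simp)+
    finally show "\<bar>g i (w i)\<bar> \<le> \<bar>C i\<bar> * lp_norm p n (delta i)" .
  qed
  then show ?thesis by (auto intro!: bdd_aboveI)
qed

lemma mdual_ge:
  assumes n: "1 \<le> n" and g: "\<And>i. i < n \<Longrightarrow> g i \<in> vecs (bdual V)"
    and w: "w \<in> tens n (vecs V)" "mnrm V n w \<le> 1"
  shows "(\<Sum>i<n. g i (w i)) \<le> mnrm (mdual V) n g"
proof -
  have "\<bar>\<Sum>i<n. g i (w i)\<bar> \<le> mnrm (mdual V) n g"
    unfolding mdual_def mnspace.simps using w by (intro cSup_upper mdual_bdd_above n g) auto
  then show ?thesis by simp
qed

lemma mdual_approx:
  assumes n: "1 \<le> n" and g: "\<And>i. i < n \<Longrightarrow> g i \<in> vecs (bdual V)" and e: "0 < e"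
  shows "\<exists>w\<in>tens n (vecs V). mnrm V n w \<le> 1 \<and> mnrm (mdual V) n g - e \<le> (\<Sum>i<n. g i (w i))"
proof -
  note A = subspace_tens[OF multinormed_subspace[OF V], of n]
  let ?S = "{\<bar>\<Sum>i<n. g i (w i)\<bar> |w. w \<in> tens n (vecs V) \<and> mnrm V n w \<le> 1}"
  \<comment> \<open>The zero tensor lies in the unit ball, so the supremum is over a nonempty
    set.\<close>
  have "mnrm V n 0 = 0"
    using multinormed_mnorm[OF V n] subspace_0[OF A] by (auto simp: norm_on_def)
  then have "?S \<noteq> {}" using subspace_0[OF A] by force
  moreover have "mnrm (mdual V) n g - e < Sup ?S"
    using e by (simp add: mdual_def)
  ultimately obtain y where "y \<in> ?S" "mnrm (mdual V) n g - e < y"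
    using less_cSupE by blast
  then obtain w where w: "w \<in> tens n (vecs V)" "mnrm V n w \<le> 1"
    "mnrm (mdual V) n g - e < \<bar>\<Sum>i<n. g i (w i)\<bar>" by blast
  show ?thesis
  proof (cases "0 \<le> (\<Sum>i<n. g i (w i))")
    case True
    then show ?thesis using w by (intro bexI[of _ w]) auto
  next
    case False
    \<comment> \<open>The supremum is over absolute values; passing to - w corrects a negative
      sign.\<close>
    have "g i ((- 1) *\<^sub>R w i) = - g i (w i)" if "i < n" for i
      using bdual_functional(1)[OF g[OF that]] w(1) that
      unfolding linear_map_on_def tens_def by (metis (mono_tags, lifting) mem_Collect_eq scaleR_minus1_left)
    then have "(\<Sum>i<n. g i (((- 1) *\<^sub>R w) i)) = - (\<Sum>i<n. g i (w i))"
      unfolding sum_negf[symmetric] by (intro sum.cong) auto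
    moreover have "mnrm V n ((- 1) *\<^sub>R w) = mnrm V n w"
      using multinormed_mnorm[OF V n] w unfolding norm_on_def by (metis abs_minus_cancel abs_one mult_1)
    ultimately show ?thesis
      using w False subspace_scale[OF A w(1), of "- 1"] by (intro bexI[of _ "(- 1) *\<^sub>R w"]) auto
  qed
qed

end

section \<open>The embeddings of general spaces and of dual spaces\<close>

lemma multinormed_embedding:
  fixes X :: "'a::real_vector mnspace"
  assumes p: "1 \<le> p" "1 / p + 1 / p' = 1" and X: "multinormed p X"
  shows "\<exists>(I :: (nat \<times> (nat \<Rightarrow> 'a \<Rightarrow> real)) set) N u. (\<forall>i\<in>I. 1 \<le> N i) \<and>
    multiisometric_embedding X (max_sum p p' I N) u"
proof -
  \<comment> \<open>Each functional serves as its own index, together with its length: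
    \<open>I\<close> collects the dual unit balls for all \<open>n\<close>. Functionals that agree
    on the carrier may occur repeatedly, which leaves the supremum unchanged.\<close>
  define I :: "(nat \<times> (nat \<Rightarrow> 'a \<Rightarrow> real)) set" where
    "I = {(n, f). 1 \<le> n \<and> (\<forall>j<n. linear_map_on (vecs X) (f j)) \<and>
      (\<forall>z\<in>tens n (vecs X). (\<Sum>j<n. f j (z j)) \<le> mnrm X n z)}"
  have "\<exists>i\<in>I. fst i = n \<and> mnrm X n z - e \<le> (\<Sum>j<n. snd i j (z j))"
    if n: "1 \<le> n" and z: "z \<in> tens n (vecs X)" and e: "0 < e" for n z and e :: real
  proof -
    obtain g where g: "linear g" "\<And>x. x \<in> tens n (vecs X) \<Longrightarrow> \<bar>g x\<bar> \<le> mnrm X n x" "g z = mnrm X n z"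
      using norming_functional[OF subspace_tens[OF multinormed_subspace[OF X]] z, of "mnrm X n"]
        multinormed_mnorm[OF X n] unfolding norm_on_def by metis
    \<comment> \<open>The components of the norming functional are its restrictions to the copies of
      \<open>X\<close> along the unit vectors.\<close>
    define f where "f j x = g (elem_tens (delta j) x)" for j x
    have "elem_tens (delta j) (x + y) = elem_tens (delta j) x + elem_tens (delta j) y"
      "elem_tens (delta j) (c *\<^sub>R x) = c *\<^sub>R elem_tens (delta j) x" for j c and x y :: 'a
      by (auto simp: elem_tens_def fun_eq_iff scaleR_add_right)
    then have lin: "linear_map_on A (f j)" for A j
      by (auto simp: linear_map_on_def f_def linear_add[OF g(1)] linear_scale[OF g(1)])
    have eq: "(\<Sum>j<n. f j (x j)) = g x" if "x \<in> tens n (vecs X)" for x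
      unfolding f_def using delta_expansion[OF that] linear_sum[OF g(1)] by metis
    have "(n, f) \<in> I"
      using n lin eq order_trans[OF abs_ge_self g(2)] by (simp add: I_def)
    then show ?thesis using eq[OF z] g(3) e by (intro bexI[of _ "(n, f)"]) auto
  qed
  then have "multiisometric_embedding X (max_sum p p' I fst)
      (\<lambda>x i j. if i \<in> I \<and> j < fst i then snd i j x else 0)"
    by (intro norming_family_embedding[OF p X]) (auto simp: I_def)
  moreover have "\<forall>i\<in>I. 1 \<le> fst i" by (auto simp: I_def)
  ultimately show ?thesis by blast
qed

text \<open>Coordinatewise weak* continuity would not suffice, since the weak* topology of the
  target tests against whole elements of the \<ell>-1 sum. The proof therefore finds, for each such
  element \<open>y\<close>, a vector of \<open>V\<close> giving the same functional on
  \<open>X\<close>.\<close>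

lemma dual_multinormed_embedding:
  fixes X :: "'a::real_vector mnspace" and V :: "'v::real_vector mnspace"
  assumes p: "1 \<le> p" "1 / p + 1 / p' = 1" and X: "multinormed p X"
    and V: "multinormed p' V" and dual: "is_dual_via X V B"
  shows "\<exists>(I :: (nat \<times> (nat \<Rightarrow> 'v)) set) N u. (\<forall>i\<in>I. 1 \<le> N i) \<and>
    multiisometric_embedding X (max_sum p p' I N) u \<and>
    continuous_map (weak_star_topology X V B)
      (weak_star_topology (max_sum p p' I N) (min_sum p p' I N) (sum_pairing I N)) u"
proof -
  define I :: "(nat \<times> (nat \<Rightarrow> 'v)) set" where
    "I = {(n, v). 1 \<le> n \<and> v \<in> tens n (vecs V) \<and> mnrm V n v \<le> 1}"
  define u where "u x i j = (if i \<in> I \<and> j < fst i then B x (snd i j) else 0)" for x i and j :: nat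
  \<comment> \<open>Only the values of \<open>B x\<close> on the carrier of \<open>V\<close> matter;
    cutting off by 0 gives genuine elements of the dual.\<close>
  define J where "J x v = (if v \<in> vecs V then B x v else 0)" for x v
  have J: "J x \<in> vecs (bdual V)" if "x \<in> vecs X" for x
    using dual that by (auto simp: is_dual_via_def Let_def J_def[abs_def] mdual_def)
  have J_lin: "linear_map_on (vecs X) J"
    and J_iso: "\<And>n z. 1 \<le> n \<Longrightarrow> z \<in> tens n (vecs X) \<Longrightarrow> mnrm (mdual V) n (\<lambda>i. J (z i)) = mnrm X n z"
    using dual by (auto simp: is_dual_via_def Let_def J_def[abs_def] multiisometric_embedding_def)
  have IN: "1 \<le> fst i" "snd i \<in> tens (fst i) (vecs V)" "mnrm V (fst i) (snd i) \<le> 1" if "i \<in> I" for i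
    using that by (auto simp: I_def)
  have vV: "snd i j \<in> vecs V" if "i \<in> I" "j < fst i" for i j
    using IN(2)[OF that(1)] that(2) by (simp add: tens_def)
  have emb: "multiisometric_embedding X (max_sum p p' I fst)
      (\<lambda>x i j. if i \<in> I \<and> j < fst i then B x (snd i j) else 0)"
  proof (rule norming_family_embedding[OF p X])
    fix i j assume "i \<in> I" "j < fst i"
    note v = vV[OF this]
    show "linear_map_on (vecs X) (\<lambda>x. B x (snd i j))"
      unfolding linear_map_on_def
    proof (intro conjI ballI allI)
      fix x y assume "x \<in> vecs X" "y \<in> vecs X"
      then have "J (x + y) (snd i j) = (J x + J y) (snd i j)"
        using J_lin by (simp add: linear_map_on_def)
      then show "B (x + y) (snd i j) = B x (snd i j) + B y (snd i j)"
        using v by (simp add: J_def)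
    next
      fix c x assume "x \<in> vecs X"
      then have "J (c *\<^sub>R x) (snd i j) = (c *\<^sub>R J x) (snd i j)"
        using J_lin by (simp add: linear_map_on_def)
      then show "B (c *\<^sub>R x) (snd i j) = c *\<^sub>R B x (snd i j)"
        using v by (simp add: J_def)
    qed
  next
    fix i z assume i: "i \<in> I" and z: "z \<in> tens (fst i) (vecs X)"
    have "(\<Sum>j<fst i. B (z j) (snd i j)) = (\<Sum>j<fst i. J (z j) (snd i j))"
      using vV[OF i] by (simp add: J_def)
    also have "\<dots> \<le> mnrm (mdual V) (fst i) (\<lambda>i. J (z i))"
      using z J IN[OF i] by (intro mdual_ge[OF p V]) (auto simp: tens_def)
    finally show "(\<Sum>j<fst i. B (z j) (snd i j)) \<le> mnrm X (fst i) z"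
      by (simp add: J_iso[OF IN(1)[OF i] z])
  next
    fix n z and e :: real assume n: "1 \<le> n" and z: "z \<in> tens n (vecs X)" and e: "0 < e"
    obtain w where w: "w \<in> tens n (vecs V)" "mnrm V n w \<le> 1"
      "mnrm (mdual V) n (\<lambda>i. J (z i)) - e \<le> (\<Sum>i<n. J (z i) (w i))"
      using mdual_approx[OF p V n _ e, of "\<lambda>i. J (z i)"] J z by (auto simp: tens_def)
    have "(\<Sum>i<n. J (z i) (w i)) = (\<Sum>i<n. B (z i) (w i))"
      using w(1) by (intro sum.cong) (auto simp: J_def tens_def)
    with w n show "\<exists>i\<in>I. fst i = n \<and> mnrm X n z - e \<le> (\<Sum>j<n. B (z j) (snd i j))"
      by (intro bexI[of _ "(n, w)"]) (auto simp: I_def J_iso[OF n z])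
  qed (auto simp: I_def)
  then have emb: "multiisometric_embedding X (max_sum p p' I fst) u"
    by (simp add: u_def[abs_def])
  have pre: "\<exists>s\<in>vecs V. \<forall>x\<in>vecs X. sum_pairing I fst (u x) y = B x s"
    if y: "y \<in> vecs (min_sum p p' I fst)" for y
  proof -
    have ys: "(\<lambda>i. lp_norm p (fst i) (y i)) summable_on I"
      using y by (simp add: min_sum_def l1_sum_def min_mn_def nrm_lp_space)
    \<comment> \<open>\<open>c i\<close> is the contribution of coordinate \<open>i\<close> to the
      preadjoint. As \<open>snd i\<close> lies in a unit ball, its norm is at most that of
      \<open>y i\<close>, so the family is absolutely summable.\<close>
    define c where "c i = (\<Sum>j<fst i. y i j *\<^sub>R snd i j)" for i
    have c: "c i \<in> vecs V" if "i \<in> I" for i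
      using vV[OF that] multinormed_subspace[OF V] by (auto simp: c_def intro!: subspace_sum subspace_scale)
    have c_nn: "0 \<le> nrm V (c i)" if "i \<in> I" for i
      using c[OF that] multinormed_norm[OF V] by (simp add: norm_on_def)
    have c_le: "nrm V (c i) \<le> lp_norm p (fst i) (y i)" if "i \<in> I" for i
    proof -
      have "nrm V (c i) \<le> lp_norm p (fst i) (y i) * mnrm V (fst i) (snd i)"
        unfolding c_def by (intro multinormed_combination_le[OF p _ V] IN that)
      also have "\<dots> \<le> lp_norm p (fst i) (y i) * 1"
        by (intro mult_left_mono lp_norm_nonneg IN that)
      finally show ?thesis by simp
    qed
    have cs: "(\<lambda>i. nrm V (c i)) summable_on I"
      by (rule summable_on_comparison_test[OF ys]) (auto simp: c_le c_nn)
    have Vb: "banach_space V" using V by (simp add: multinormed_def)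
    obtain s where s: "s \<in> vecs V" and
      sum: "\<And>\<phi> C. linear_map_on (vecs V) \<phi> \<Longrightarrow> \<forall>v\<in>vecs V. \<bar>\<phi> v\<bar> \<le> C * nrm V v \<Longrightarrow>
        \<phi> s = (\<Sum>\<^sub>\<infinity>i\<in>I. \<phi> (c i) :: real)"
      using banach_infsum_exists[OF Vb c cs] by blast
    have "sum_pairing I fst (u x) y = B x s" if x: "x \<in> vecs X" for x
    proof -
      note bd = bdual_functional[OF J[OF x]]
      have "J x (c i) = (\<Sum>j<fst i. u x i j * y i j)" if i: "i \<in> I" for i
      proof -
        have "J x (c i) = (\<Sum>j<fst i. y i j *\<^sub>R J x (snd i j))"
          unfolding c_def using vV[OF i]
          by (intro linear_map_on_sum[OF multinormed_subspace[OF V] bd(1)]) auto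
        then show ?thesis using i vV[OF i] by (simp add: u_def J_def mult.commute)
      qed
      \<comment> \<open>The bounded functional \<open>J x\<close> commutes with the sum of the
        \<open>c i\<close>, which turns the infinite pairing into evaluation at
        \<open>s\<close>.\<close>
      then have "(\<Sum>\<^sub>\<infinity>i\<in>I. J x (c i)) = sum_pairing I fst (u x) y"
        unfolding sum_pairing_def by (intro infsum_cong) auto
      moreover obtain C where "\<forall>v\<in>vecs V. \<bar>J x v\<bar> \<le> C * nrm V v" using bd(2) by blast
      ultimately show ?thesis using sum[OF bd(1)] s by (simp add: J_def)
    qed
    with s show ?thesis by blast
  qed
  have top: "topspace (weak_star_topology X V B) \<subseteq> vecs X"
    by (auto simp: weak_star_topology_def topspace_pullback_topology)
  have "continuous_map (weak_star_topology X V B)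
      (weak_star_topology (max_sum p p' I fst) (min_sum p p' I fst) (sum_pairing I fst)) u"
    unfolding weak_star_topology_def[of "max_sum p p' I fst"]
  proof (rule continuous_map_pullback')
    show "topspace (weak_star_topology X V B) \<subseteq> u -` vecs (max_sum p p' I fst)"
      using top emb by (auto simp: multiisometric_embedding_def)
    \<comment> \<open>The target topology is initial for the pairings with such \<open>y\<close>;
      composed with \<open>u\<close>, each of these is evaluation at some \<open>s\<close>, a
      coordinate map of the source topology.\<close>
    have "continuous_map (weak_star_topology X V B) euclideanreal (\<lambda>x. sum_pairing I fst (u x) y)"
      if y: "y \<in> vecs (min_sum p p' I fst)" for y
    proof -
      obtain s where s: "s \<in> vecs V" "\<And>x. x \<in> vecs X \<Longrightarrow> sum_pairing I fst (u x) y = B x s"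
        using pre[OF y] by blast
      have "continuous_map (weak_star_topology X V B) euclideanreal
          ((\<lambda>g. g s) \<circ> (\<lambda>x. restrict (B x) (vecs V)))"
        unfolding weak_star_topology_def
        by (intro continuous_map_pullback continuous_map_product_projection s)
      then show ?thesis
        by (rule continuous_map_eq) (use s top in auto)
    qed
    then show "continuous_map (weak_star_topology X V B)
        (product_topology (\<lambda>_. euclideanreal) (vecs (min_sum p p' I fst)))
        ((\<lambda>x. restrict (sum_pairing I fst x) (vecs (min_sum p p' I fst))) \<circ> u)"
      by (auto simp: continuous_map_componentwise)
  qed
  with emb IN(1) show ?thesis by blast
qed


theorem theorem3p7:
  fixes p p' :: ennreal and X :: "'a::real_vector mnspace"
  assumes "1 \<le> p" and "1 / p + 1 / p' = 1"
    and "multinormed p X"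
  shows "(\<exists>(I :: (nat \<times> (nat \<Rightarrow> 'a \<Rightarrow> real)) set) N u.
            (\<forall>i\<in>I. 1 \<le> N i) \<and>
            multiisometric_embedding X (max_sum p p' I N) u) \<and>
         (\<forall>(V :: 'v::real_vector mnspace) B.
            multinormed p' V \<and> is_dual_via X V B \<longrightarrow>
            (\<exists>(I :: (nat \<times> (nat \<Rightarrow> 'v)) set) N u.
               (\<forall>i\<in>I. 1 \<le> N i) \<and>
               multiisometric_embedding X (max_sum p p' I N) u \<and>
               continuous_map (weak_star_topology X V B)
                 (weak_star_topology (max_sum p p' I N) (min_sum p p' I N) (sum_pairing I N)) u))"
  using multinormed_embedding[OF assms] dual_multinormed_embedding[OF assms] by blast

end
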